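(* There exists an absolute constant $C>0$ such that the following holds. Let $N\ge 2$, $0<\epsilon<1$, let $\Omega\subset\{1,\dots,N\}$ be an arbitrary (deterministic) set of cardinality $n<N$, and let $s\in\mathbb{N}$. Let $x\in\mathbb{R}^N$ be an $s$-sparse vector (i.e. $|\{j: x_j\neq 0\}|\le s$) with fixed support and fixed magnitudes $|x_j|$, whose signs $\operatorname{sgn}(x_j)$ on the support are independent Bernoulli $\pm1$ random variables. Let $b=(b_0,\dots,b_{N-1})\in\mathbb{R}^N$ be a random vector with independent Bernoulli $\pm1$ entries, independent of the signs of $x$, and let $y=S^b_\Omega x\in\mathbb{R}^n$. If $$ n\ge C\, s\,\log^3(N/\epsilon),$$ then with probability at least $1-\epsilon$ the solution of the $\ell_1$-minimization problem $$\min_{z\in\mathbb{R}^N}\|z\|_1\quad\text{subject to } S^b_\Omega z=y$$ coincides with $x$. The same statement holds with $T^c_\Omega$ in place of $S^b_\Omega$, where $c=(c_{-N+1},\dots,c_{N-1})\in\mathbb{R}^{2N-1}$ is a random vector with independent Bernoulli $\pm1$ entries (independent of the signs of $x$) and $y=T^c_\Omega x$.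
   Context: A Bernoulli $\pm1$ random variable takes the values $+1$ and $-1$ with probability $1/2$ each. For $b=(b_0,\dots,b_{N-1})\in\mathbb{R}^N$ the circulant matrix $S^b\in\mathbb{R}^{N\times N}$ has entries $S^b_{i,j}=b_{(j-i)\bmod N}$, $i,j=1,\dots,N$. For $c=(c_{-N+1},\dots,c_{N-1})$ the Toeplitz matrix $T^c\in\mathbb{R}^{N\times N}$ has entries $T^c_{i,j}=c_{j-i}$. For $\Omega\subset\{1,\dots,N\}$ with $|\Omega|=n$, $S^b_\Omega\in\mathbb{R}^{n\times N}$ (resp. $T^c_\Omega$) is the submatrix of $S^b$ (resp. $T^c$) consisting of the rows indexed by $\Omega$. *)

theory Defs
  imports "HOL-Probability.Probability"
begin

text \<open>Vectors in R^N are functions nat => real; only indices 0..N-1 matter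
 (0-based indexing of the paper's 1..N).\<close>

definition l1norm :: "nat \<Rightarrow> (nat \<Rightarrow> real) \<Rightarrow> real" where
  "l1norm N z = (\<Sum>j<N. \<bar>z j\<bar>)"

definition circ_row :: "nat \<Rightarrow> (nat \<Rightarrow> real) \<Rightarrow> nat \<Rightarrow> (nat \<Rightarrow> real) \<Rightarrow> real" where
  "circ_row N b i z = (\<Sum>j<N. b (nat ((int j - int i) mod int N)) * z j)"

definition toep_row :: "nat \<Rightarrow> (int \<Rightarrow> real) \<Rightarrow> nat \<Rightarrow> (nat \<Rightarrow> real) \<Rightarrow> real" where
  "toep_row N c i z = (\<Sum>j<N. c (int j - int i) * z j)"

definition l1_recovers ::
  "nat \<Rightarrow> nat set \<Rightarrow> (nat \<Rightarrow> (nat \<Rightarrow> real) \<Rightarrow> real) \<Rightarrow> (nat \<Rightarrow> real) \<Rightarrow> bool" where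
  "l1_recovers N \<Omega> rw x \<longleftrightarrow>
     (\<forall>z. (\<forall>i\<in>\<Omega>. rw i z = rw i x) \<and> (\<exists>j<N. z j \<noteq> x j)
           \<longrightarrow> l1norm N x < l1norm N z)"

definition signed_vec :: "nat set \<Rightarrow> (nat \<Rightarrow> real) \<Rightarrow> (nat \<Rightarrow> real) \<Rightarrow> nat \<Rightarrow> real" where
  "signed_vec T m \<sigma> j = (if j \<in> T then \<sigma> j * m j else 0)"

end

theory Submission
  imports Defs
begin

text \<open>
  A Toeplitz matrix of size \<open>N\<close> is a submatrix of a circulant matrix of size \<open>2 N - 1\<close>, so only the
  circulant case needs an argument. Let \<open>G = A\<^sub>T\<^sup>* A\<^sub>T / n - 1\<close> be the centred Gram matrix of the columns
  in \<open>T\<close>. If \<open>G\<close> has small operator norm, then \<open>x\<close> is recovered as soon as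
  \<open>\<bar>\<langle>(1 + G)\<^sup>-\<^sup>1 g\<^sub>l, \<sigma>\<rangle>\<bar> < 1\<close> for every column \<open>l \<notin> T\<close>, where \<open>g\<^sub>l\<close> holds the correlations of column \<open>l\<close>
  with those in \<open>T\<close>; for fixed \<open>b\<close> this is Hoeffding's inequality in the random signs \<open>\<sigma>\<close>, provided the
  norm of \<open>g\<^sub>l\<close> is at most a constant times \<open>1 / sqrt (ln (N / \<epsilon>))\<close>. Both norm conditions follow from
  a bound on the operator norm of the Gram matrix of \<open>insert l T\<close>.

  That Gram matrix is a homogeneous Rademacher chaos of order two in \<open>b\<close>. Resampling one sign at a time
  bounds the trace moment \<open>E tr G^(2p)\<close> by \<open>(2 p - 1) / 4\<close> times \<open>E \<Sum>a. tr (H\<^sub>a\<^sup>2 G^(2p-2))\<close>, where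
  \<open>H\<^sub>a\<close> is the change of \<open>G\<close> when \<open>b\<^sub>a\<close> is flipped; no decoupling is needed. The sum of the \<open>H\<^sub>a\<^sup>2\<close> is
  dominated by \<open>G\<close> itself and by the largest squared Fourier coefficient of \<open>b\<close> restricted to shifts of
  \<open>\<Omega>\<close>, whose moments are those of scalar Rademacher sums. Taking \<open>p\<close> of order \<open>ln (N / \<epsilon>)\<close> produces
  the third power of the logarithm.
\<close>

section \<open>Rademacher sums over the sign cube\<close>

abbreviation cube :: "'a set \<Rightarrow> ('a \<Rightarrow> real) set" where
  "cube I \<equiv> PiE I (\<lambda>_. {-1, 1})"

text \<open>Hoeffding's lemma for a two-point variable: \<open>Hoeffdings_lemma_aux\<close> with
  parameter \<open>1/2\<close> at \<open>2*y\<close>, exponentiated and multiplied by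
  \<open>exp (-y)\<close>. Evenness of \<open>cosh\<close> reduces everything to positive
  arguments.\<close>

lemma cosh_le_exp_half_square:
  fixes x :: real
  shows "cosh x \<le> exp (x\<^sup>2 / 2)"
proof -
  have pos: "cosh y \<le> exp (y\<^sup>2 / 2)" if "y > 0" for y :: real
  proof -
    have "- (2*y) * (1/2) + ln (1 + (1/2) * (exp (2*y) - 1)) \<le> (2*y)\<^sup>2 / 8"
      using that by (intro Hoeffdings_lemma_aux) auto
    hence "ln (1 + (1/2) * (exp (2*y) - 1)) \<le> y\<^sup>2 / 2 + y"
      by (simp add: power2_eq_square)
    moreover have "1 + (1/2) * (exp (2*y) - 1) > 0"
      by (simp add: field_simps add_pos_pos)
    ultimately have "1 + (1/2) * (exp (2*y) - 1) \<le> exp (y\<^sup>2 / 2 + y)"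
      by (metis exp_le_cancel_iff exp_ln)
    hence "exp (-y) * (1 + (1/2) * (exp (2*y) - 1)) \<le> exp (-y) * exp (y\<^sup>2 / 2 + y)"
      by simp
    also have "exp (-y) * exp (y\<^sup>2 / 2 + y) = exp (y\<^sup>2 / 2)"
      by (simp flip: exp_add)
    also have "exp (-y) * (1 + (1/2) * (exp (2*y) - 1)) = cosh y"
      by (simp add: cosh_field_def algebra_simps flip: exp_add)
    finally show ?thesis .
  qed
  show ?thesis
    using pos[of x] pos[of "-x"] by (cases x "0::real" rule: linorder_cases) auto
qed

lemma finite_cube [simp, intro]: "finite I \<Longrightarrow> finite (cube I)"
  by (auto intro: finite_PiE)

lemma cube_nonempty: "cube I \<noteq> {}"
  by (auto simp: PiE_eq_empty_iff)

lemma card_cube: "finite I \<Longrightarrow> card (cube I) = 2 ^ card I"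
  by (simp add: card_PiE numeral_2_eq_2)

lemma cubeD: "b \<in> cube I \<Longrightarrow> a \<in> I \<Longrightarrow> b a = -1 \<or> b a = 1"
  by (auto simp: PiE_def Pi_def)

lemma cube_square: "b \<in> cube I \<Longrightarrow> a \<in> I \<Longrightarrow> b a * b a = 1"
  using cubeD by fastforce

text \<open>The exponential factorises over the coordinates into factors
  \<open>2 * cosh (c i)\<close>.\<close>

lemma cube_exp_sum_le:
  assumes "finite I"
  shows "(\<Sum>b\<in>cube I. exp (\<Sum>i\<in>I. c i * b i)) \<le> 2 ^ card I * exp ((\<Sum>i\<in>I. (c i)\<^sup>2) / 2)"
proof -
  have "(\<Sum>b\<in>cube I. exp (\<Sum>i\<in>I. c i * b i)) = (\<Sum>b\<in>cube I. \<Prod>i\<in>I. exp (c i * b i))"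
    using assms by (simp add: exp_sum)
  also have "\<dots> = (\<Prod>i\<in>I. \<Sum>y\<in>{-1,1}. exp (c i * y))"
    using assms by (subst prod_sum_PiE) auto
  also have "\<dots> = (\<Prod>i\<in>I. 2 * cosh (c i))"
    by (intro prod.cong) (auto simp: cosh_field_def)
  also have "\<dots> \<le> (\<Prod>i\<in>I. 2 * exp ((c i)\<^sup>2 / 2))"
    by (intro prod_mono) (auto simp: cosh_le_exp_half_square)
  also have "\<dots> = 2 ^ card I * exp ((\<Sum>i\<in>I. (c i)\<^sup>2) / 2)"
    using assms by (simp add: prod.distrib exp_sum sum_divide_distrib)
  finally show ?thesis .
qed

lemma cube_exp_abs_sum_le:
  assumes "finite I"
  shows "(\<Sum>b\<in>cube I. exp \<bar>\<Sum>i\<in>I. c i * b i\<bar>) \<le> 2 * 2 ^ card I * exp ((\<Sum>i\<in>I. (c i)\<^sup>2) / 2)"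
proof -
  have "exp \<bar>x\<bar> \<le> exp x + exp (-x)" for x :: real
    by (cases "x \<ge> 0") (auto simp: abs_if)
  hence "(\<Sum>b\<in>cube I. exp \<bar>\<Sum>i\<in>I. c i * b i\<bar>)
      \<le> (\<Sum>b\<in>cube I. exp (\<Sum>i\<in>I. c i * b i) + exp (- (\<Sum>i\<in>I. c i * b i)))"
    by (intro sum_mono)
  also have "\<dots> = (\<Sum>b\<in>cube I. exp (\<Sum>i\<in>I. c i * b i)) + (\<Sum>b\<in>cube I. exp (\<Sum>i\<in>I. (- c i) * b i))"
    by (simp add: sum.distrib sum_negf)
  also have "\<dots> \<le> 2 ^ card I * exp ((\<Sum>i\<in>I. (c i)\<^sup>2) / 2) + 2 ^ card I * exp ((\<Sum>i\<in>I. (- c i)\<^sup>2) / 2)"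
    by (intro add_mono cube_exp_sum_le assms)
  finally show ?thesis by simp
qed

lemma cube_hoeffding:
  assumes I: "finite I" and Q: "Q > 0" "(\<Sum>i\<in>I. (c i)\<^sup>2) \<le> Q"
  shows "real (card {b \<in> cube I. 1/2 \<le> \<bar>\<Sum>i\<in>I. c i * b i\<bar>}) \<le> 2 * 2 ^ card I * exp (- 1 / (8 * Q))"
    (is "real (card ?B) \<le> _")
proof -
  \<comment> \<open>Chernoff parameter minimising \<open>r\<^sup>2 * Q / 2 - r / 2\<close>; the
    minimum is \<open>- 1 / (8 * Q)\<close>.\<close>
  define r where "r = 1 / (2 * Q)"
  have r: "r > 0" using Q by (simp add: r_def)
  have "real (card ?B) * exp (r / 2) = (\<Sum>b\<in>?B. exp (r / 2))"
    by simp
  also have "\<dots> \<le> (\<Sum>b\<in>?B. exp \<bar>\<Sum>i\<in>I. (r * c i) * b i\<bar>)"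
  proof (intro sum_mono)
    fix b assume "b \<in> ?B"
    hence "r * (1/2) \<le> r * \<bar>\<Sum>i\<in>I. c i * b i\<bar>"
      using r by (intro mult_left_mono) auto
    also have "\<dots> = \<bar>\<Sum>i\<in>I. (r * c i) * b i\<bar>"
      using r by (simp add: abs_mult sum_distrib_left mult.assoc flip: sum_distrib_left)
    finally show "exp (r / 2) \<le> exp \<bar>\<Sum>i\<in>I. (r * c i) * b i\<bar>" by simp
  qed
  also have "\<dots> \<le> (\<Sum>b\<in>cube I. exp \<bar>\<Sum>i\<in>I. (r * c i) * b i\<bar>)"
    using I by (intro sum_mono2) auto
  also have "\<dots> \<le> 2 * 2 ^ card I * exp ((\<Sum>i\<in>I. (r * c i)\<^sup>2) / 2)"
    by (rule cube_exp_abs_sum_le[OF I])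
  also have "\<dots> \<le> 2 * 2 ^ card I * exp (r\<^sup>2 * Q / 2)"
    using Q by (simp add: power_mult_distrib mult_left_mono flip: sum_distrib_left)
  also have "r\<^sup>2 * Q / 2 = - 1 / (8 * Q) + r / 2"
    using Q by (simp add: r_def power2_eq_square field_simps)
  finally have "real (card ?B) * exp (r / 2) \<le> (2 * 2 ^ card I * exp (- 1 / (8 * Q))) * exp (r / 2)"
    by (simp only: exp_add mult.assoc)
  thus ?thesis
    by (rule mult_right_le_imp_le) simp
qed

text \<open>\<open>t ^ (2*p) \<le> exp (2 * p * t)\<close> turns an even moment into an exponential
  moment. The constant 6 is the factor 2 of the rescaling times the bound 3 for
  \<open>exp 1\<close>.\<close>

lemma cube_moment_le:
  assumes I: "finite I" and n: "n > 0" "(\<Sum>i\<in>I. (c i)\<^sup>2) \<le> n" and p: "p > 0"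
  shows "(\<Sum>b\<in>cube I. (\<Sum>i\<in>I. c i * b i) ^ (2*p)) \<le> 2 ^ card I * (2 * (6 * real p * n) ^ p)"
proof -
  \<comment> \<open>With this scale the exponent supplied by \<open>cube_exp_abs_sum_le\<close> is
    at most \<open>p\<close>.\<close>
  define r where "r = sqrt (2 * real p / n)"
  have r: "r > 0" and r2: "r\<^sup>2 = 2 * real p / n" using n p by (auto simp: r_def)
  have pt: "(\<Sum>i\<in>I. c i * b i) ^ (2*p) \<le> (2 * real p * n) ^ p * exp \<bar>\<Sum>i\<in>I. (r * c i) * b i\<bar>" for b
  proof -
    define x where "x = (\<Sum>i\<in>I. c i * b i)"
    have rx: "(\<Sum>i\<in>I. (r * c i) * b i) = r * x"
      by (simp add: x_def sum_distrib_left mult.assoc)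
    define t where "t = \<bar>r * x\<bar> / (2 * real p)"
    have "t \<le> exp t" using exp_ge_add_one_self[of t] by linarith
    hence "t ^ (2*p) \<le> exp t ^ (2*p)" by (intro power_mono) (auto simp: t_def)
    also have "\<dots> = exp \<bar>r * x\<bar>" using p by (simp add: t_def flip: exp_of_nat_mult)
    finally have 1: "t ^ (2*p) \<le> exp \<bar>r * x\<bar>" .
    have "t\<^sup>2 * (2 * real p * n) = x\<^sup>2"
    proof -
      have "t\<^sup>2 = r\<^sup>2 * x\<^sup>2 / (2 * real p)\<^sup>2"
        by (simp add: t_def power_divide power_mult_distrib)
      thus ?thesis using p n by (simp add: r2) (simp add: power2_eq_square)
    qed
    hence "x ^ (2*p) = (t\<^sup>2 * (2 * real p * n)) ^ p" by (simp add: power_mult)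
    also have "\<dots> = (2 * real p * n) ^ p * t ^ (2*p)"
      by (simp add: power_mult_distrib power_mult)
    also have "\<dots> \<le> (2 * real p * n) ^ p * exp \<bar>r * x\<bar>"
      using 1 n by (intro mult_left_mono) auto
    finally show ?thesis unfolding rx x_def[symmetric] .
  qed
  have "(\<Sum>b\<in>cube I. (\<Sum>i\<in>I. c i * b i) ^ (2*p))
      \<le> (\<Sum>b\<in>cube I. (2 * real p * n) ^ p * exp \<bar>\<Sum>i\<in>I. (r * c i) * b i\<bar>)"
    by (intro sum_mono pt)
  also have "\<dots> = (2 * real p * n) ^ p * (\<Sum>b\<in>cube I. exp \<bar>\<Sum>i\<in>I. (r * c i) * b i\<bar>)"
    by (simp add: sum_distrib_left)
  also have "\<dots> \<le> (2 * real p * n) ^ p * (2 * 2 ^ card I * exp ((\<Sum>i\<in>I. (r * c i)\<^sup>2) / 2))"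
    using n by (intro mult_left_mono cube_exp_abs_sum_le I) auto
  also have "\<dots> \<le> (2 * real p * n) ^ p * (2 * 2 ^ card I * exp (real p))"
  proof -
    have "(\<Sum>i\<in>I. (r * c i)\<^sup>2) \<le> r\<^sup>2 * n"
      using n by (simp add: power_mult_distrib mult_left_mono flip: sum_distrib_left)
    also have "\<dots> = 2 * real p" using n by (simp add: r2)
    finally show ?thesis using n by (intro mult_left_mono) auto
  qed
  also have "\<dots> \<le> (2 * real p * n) ^ p * (2 * 2 ^ card I * 3 ^ p)"
  proof -
    have "exp (real p) = exp 1 ^ p" by (simp flip: exp_of_nat_mult)
    also have "\<dots> \<le> 3 ^ p" using exp_le by (intro power_mono) auto
    finally show ?thesis using n by (intro mult_left_mono) auto
  qed
  also have "\<dots> = 2 ^ card I * (2 * (6 * real p * n) ^ p)"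
  proof -
    have "(6 * real p * n) ^ p = (2 * real p * n) ^ p * 3 ^ p"
      by (subst power_mult_distrib[symmetric]) (simp add: mult_ac)
    thus ?thesis by simp
  qed
  finally show ?thesis .
qed

section \<open>Flipping a single sign\<close>

definition flip :: "'a \<Rightarrow> ('a \<Rightarrow> real) \<Rightarrow> 'a \<Rightarrow> real" where
  "flip a b = b(a := - b a)"

lemma flip_flip [simp]: "flip a (flip a b) = b"
  by (auto simp: flip_def)

lemma flip_in_cube: "a \<in> I \<Longrightarrow> b \<in> cube I \<Longrightarrow> flip a b \<in> cube I"
  by (auto simp: flip_def PiE_def Pi_def extensional_def)

text \<open>The flip is an involution of the cube, so uniform averages are invariant; resampling a
  sign is expressed through this change of variables.\<close>

lemma sum_cube_flip:
  assumes "a \<in> I"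
  shows "(\<Sum>b\<in>cube I. f (flip a b)) = (\<Sum>b\<in>cube I. f b)"
  by (rule sum.reindex_bij_witness[of _ "flip a" "flip a"]) (simp_all add: flip_in_cube assms)

section \<open>Matrices indexed by a finite set\<close>

type_synonym 'a matr = "'a \<Rightarrow> 'a \<Rightarrow> real"

text \<open>Products are cut off to zero outside \<open>T\<close>, so that associativity and power
  laws become equalities of functions. The factors themselves may have arbitrary entries outside
  \<open>T\<close>.\<close>

definition mmul :: "'a set \<Rightarrow> 'a matr \<Rightarrow> 'a matr \<Rightarrow> 'a matr" where
  "mmul T A B = (\<lambda>i j. if i \<in> T \<and> j \<in> T then \<Sum>k\<in>T. A i k * B k j else 0)"

definition mone :: "'a set \<Rightarrow> 'a matr" where
  "mone T = (\<lambda>i j. if i = j \<and> i \<in> T then 1 else 0)"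

primrec mpow :: "'a set \<Rightarrow> 'a matr \<Rightarrow> nat \<Rightarrow> 'a matr" where
  "mpow T A 0 = mone T"
| "mpow T A (Suc n) = mmul T A (mpow T A n)"

definition mtr :: "'a set \<Rightarrow> 'a matr \<Rightarrow> real" where
  "mtr T A = (\<Sum>i\<in>T. A i i)"

definition mtrans :: "'a matr \<Rightarrow> 'a matr" where
  "mtrans A = (\<lambda>i j. A j i)"

definition msym :: "'a set \<Rightarrow> 'a matr \<Rightarrow> bool" where
  "msym T A \<longleftrightarrow> (\<forall>i\<in>T. \<forall>j\<in>T. A i j = A j i)"

text \<open>The Hilbert-Schmidt inner product; \<open>hs T A A\<close> is the squared Frobenius norm
  on \<open>T\<close>.\<close>

definition hs :: "'a set \<Rightarrow> 'a matr \<Rightarrow> 'a matr \<Rightarrow> real" where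
  "hs T A B = (\<Sum>i\<in>T. \<Sum>j\<in>T. A i j * B i j)"

lemma mmul_assoc: "mmul T (mmul T A B) C = mmul T A (mmul T B C)"
proof (intro ext)
  fix i j
  have "(\<Sum>k\<in>T. (\<Sum>l\<in>T. A i l * B l k) * C k j) = (\<Sum>l\<in>T. A i l * (\<Sum>k\<in>T. B l k * C k j))"
    by (simp add: sum_distrib_left sum_distrib_right mult.assoc) (rule sum.swap)
  thus "mmul T (mmul T A B) C i j = mmul T A (mmul T B C) i j"
    by (simp add: mmul_def cong: sum.cong)
qed

lemma mtr_comm: "mtr T (mmul T A B) = mtr T (mmul T B A)"
proof -
  have "(\<Sum>i\<in>T. \<Sum>k\<in>T. A i k * B k i) = (\<Sum>i\<in>T. \<Sum>k\<in>T. B i k * A k i)"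
    by (subst sum.swap) (simp add: mult.commute)
  thus ?thesis by (simp add: mtr_def mmul_def cong: sum.cong)
qed

lemma mtrans_mmul: "mtrans (mmul T A B) = mmul T (mtrans B) (mtrans A)"
  by (auto simp: mtrans_def mmul_def fun_eq_iff mult.commute)

lemma mmul_cong:
  assumes "\<And>i j. i \<in> T \<Longrightarrow> j \<in> T \<Longrightarrow> A i j = A' i j" "\<And>i j. i \<in> T \<Longrightarrow> j \<in> T \<Longrightarrow> B i j = B' i j"
  shows "mmul T A B = mmul T A' B'"
  using assms by (auto simp: mmul_def fun_eq_iff intro!: sum.cong)

lemma mmul_one_left:
  assumes "finite T"
  shows "mmul T (mone T) (mmul T A B) = mmul T A B"
  using assms by (auto simp: mmul_def mone_def fun_eq_iff if_distrib[of "\<lambda>x. x * _"] cong: if_cong)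

lemma mmul_one_one: "finite T \<Longrightarrow> mmul T (mone T) (mone T) = mone T"
  by (auto simp: mmul_def mone_def fun_eq_iff if_distrib[of "\<lambda>x. x * _"] cong: if_cong)

lemma mmul_one_mpow: "finite T \<Longrightarrow> mmul T (mone T) (mpow T A n) = mpow T A n"
  by (cases n) (auto simp: mmul_one_one mmul_one_left)

lemma mpow_add: "finite T \<Longrightarrow> mpow T A (m + n) = mmul T (mpow T A m) (mpow T A n)"
  by (induction m) (auto simp: mmul_one_mpow mmul_assoc)

lemma mtr_one [simp]: "mtr T (mone T) = real (card T)"
  by (simp add: mtr_def mone_def)

lemma mtrans_mpow:
  assumes "finite T" "msym T A"
  shows "mtrans (mpow T A n) = mpow T A n"
proof (induction n)
  case 0
  show ?case by (auto simp: mtrans_def mone_def fun_eq_iff)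
next
  case (Suc n)
  have "mmul T (mpow T A k) A = mmul T A (mpow T A k)" for k
  proof (induction k)
    case 0
    show ?case using assms(1)
      by (auto simp: mmul_def mone_def fun_eq_iff if_distrib[of "\<lambda>x. x * _"] if_distrib[of "\<lambda>x. _ * x"] cong: if_cong)
  next
    case (Suc k)
    thus ?case by (simp add: mmul_assoc)
  qed
  moreover have "mmul T (mpow T A n) (mtrans A) = mmul T (mpow T A n) A"
    using assms(2) by (intro mmul_cong) (auto simp: mtrans_def msym_def)
  ultimately show ?case using Suc by (simp add: mtrans_mmul)
qed

section \<open>Hilbert-Schmidt inequalities and convexity of trace moments\<close>

lemma hs_eq_mtr: "hs T A B = mtr T (mmul T (mtrans A) B)"
  unfolding hs_def mtr_def mmul_def mtrans_def by (subst sum.swap) (auto intro!: sum.cong)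

lemma hs_nonneg: "0 \<le> hs T A A"
  unfolding hs_def by (intro sum_nonneg) auto

text \<open>Entrywise AM-GM. The free weight \<open>c\<close> later balances matrix powers of
  different size.\<close>

lemma hs_amgm:
  assumes "c > 0"
  shows "2 * \<bar>hs T A B\<bar> \<le> c * hs T A A + hs T B B / c"
proof -
  have "2 * \<bar>hs T A B\<bar> \<le> 2 * (\<Sum>i\<in>T. \<Sum>j\<in>T. \<bar>A i j * B i j\<bar>)"
    unfolding hs_def by (intro mult_left_mono order.trans[OF sum_abs] sum_mono) auto
  also have "\<dots> = (\<Sum>i\<in>T. \<Sum>j\<in>T. 2 * \<bar>A i j * B i j\<bar>)"
    by (simp add: sum_distrib_left)
  also have "\<dots> \<le> (\<Sum>i\<in>T. \<Sum>j\<in>T. c * (A i j * A i j) + (B i j * B i j) / c)"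
  proof (intro sum_mono)
    fix i j
    have "0 \<le> (c * \<bar>A i j\<bar> - \<bar>B i j\<bar>)\<^sup>2 / c" using assms by simp
    also have "\<dots> = c * (A i j * A i j) + (B i j * B i j) / c - 2 * \<bar>A i j * B i j\<bar>"
      using assms by (simp add: power2_diff abs_mult power_mult_distrib power2_abs field_simps)
         (simp add: power2_eq_square)
    finally show "2 * \<bar>A i j * B i j\<bar> \<le> c * (A i j * A i j) + (B i j * B i j) / c"
      by simp
  qed
  also have "\<dots> = c * hs T A A + hs T B B / c"
    by (simp add: hs_def sum.distrib sum_distrib_left sum_divide_distrib)
  finally show ?thesis .
qed

text \<open>A discrete maximum principle: the least index attaining the maximum cannot be interior,
  since convexity would make its left neighbour a maximiser too.\<close>

lemma discrete_convex_le_max: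
  fixes g :: "nat \<Rightarrow> real"
  assumes convex: "\<And>a. 0 < a \<Longrightarrow> a < r \<Longrightarrow> 2 * g a \<le> g (a - 1) + g (a + 1)" and "a \<le> r"
  shows "g a \<le> max (g 0) (g r)"
proof (rule ccontr)
  assume contra: "\<not> ?thesis"
  define S where "S = Max (g ` {..r})"
  have le: "g k \<le> S" if "k \<le> r" for k using that by (auto simp: S_def)
  have "\<exists>k. k \<le> r \<and> g k = S"
    using Max_in[of "g ` {..r}"] by (fastforce simp: S_def)
  define k where "k = (LEAST k. k \<le> r \<and> g k = S)"
  have k: "k \<le> r" "g k = S" using LeastI_ex[OF \<open>\<exists>k. _\<close>] by (auto simp: k_def)
  have "max (g 0) (g r) < g k" using contra k(2) le[OF \<open>a \<le> r\<close>] by linarith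
  hence "g 0 < g k" "g r < g k" by auto
  hence k0: "k \<noteq> 0" "k \<noteq> r" by (metis less_irrefl)+
  have "\<not> (k - 1 \<le> r \<and> g (k - 1) = S)"
    using not_less_Least[of "k - 1" "\<lambda>k. k \<le> r \<and> g k = S"] k0 by (auto simp: k_def)
  hence "g (k - 1) < S" using le[of "k - 1"] k by fastforce
  moreover have "g (k + 1) \<le> S" using k k0 by (intro le) auto
  moreover have "2 * g k \<le> g (k - 1) + g (k + 1)" using k k0 by (intro convex) auto
  ultimately show False using k by simp
qed

text \<open>Noncommutative telescoping of \<open>P^n - M^n\<close>: each summand has one factor
  replaced by the difference \<open>D\<close>. Induction over all \<open>X\<close> lets the leading
  \<open>P\<close> be absorbed into \<open>X\<close>.\<close>

lemma mtr_telescope: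
  assumes T: "finite T" and D: "\<And>i j. i \<in> T \<Longrightarrow> j \<in> T \<Longrightarrow> D i j = P i j - M i j"
  shows "mtr T (mmul T X (mpow T P n)) - mtr T (mmul T X (mpow T M n)) =
    (\<Sum>q<n. mtr T (mmul T X (mmul T (mpow T P q) (mmul T D (mpow T M (n - Suc q))))))"
proof (induction n arbitrary: X)
  case 0
  show ?case by simp
next
  case (Suc n)
  have "mmul T D (mpow T M n) = (\<lambda>i j. mmul T P (mpow T M n) i j - mmul T M (mpow T M n) i j)"
    using D by (auto simp: mmul_def fun_eq_iff left_diff_distrib sum_subtractf)
  hence split: "mtr T (mmul T X (mmul T D (mpow T M n))) =
      mtr T (mmul T X (mmul T P (mpow T M n))) - mtr T (mmul T X (mpow T M (Suc n)))"
    by (simp add: mtr_def mmul_def[of T X] right_diff_distrib sum_subtractf)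
  have "mtr T (mmul T X (mpow T P (Suc n))) - mtr T (mmul T X (mpow T M (Suc n))) =
      (mtr T (mmul T (mmul T X P) (mpow T P n)) - mtr T (mmul T (mmul T X P) (mpow T M n)))
      + mtr T (mmul T X (mmul T D (mpow T M n)))"
    using split by (simp add: mmul_assoc)
  also have "\<dots> = (\<Sum>q<n. mtr T (mmul T X (mmul T (mpow T P (Suc q)) (mmul T D (mpow T M (Suc n - Suc (Suc q)))))))
      + mtr T (mmul T X (mmul T (mpow T P 0) (mmul T D (mpow T M (Suc n - Suc 0)))))"
    using T unfolding Suc.IH[of "mmul T X P"] by (simp add: mmul_assoc mmul_one_left)
  also have "\<dots> = (\<Sum>q<Suc n. mtr T (mmul T X (mmul T (mpow T P q) (mmul T D (mpow T M (Suc n - Suc q))))))"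
    by (subst sum.lessThan_Suc_shift) simp
  finally show ?case .
qed

lemma mtr_mmul_one:
  assumes "finite T"
  shows "mtr T (mmul T X (mone T)) = mtr T X"
  using assms by (simp add: mtr_def mmul_def mone_def if_distrib[of "\<lambda>x. _ * x"] cong: if_cong)

lemma hs_mmul_mpow:
  assumes T: "finite T" and A: "msym T A"
  shows "hs T (mmul T (mpow T A k) X) (mmul T (mpow T A l) X) = mtr T (mmul T (mtrans X) (mmul T (mpow T A (k + l)) X))"
  using assms by (simp add: hs_eq_mtr mtrans_mmul mtrans_mpow mmul_assoc mpow_add)

lemma hs_mpow:
  assumes T: "finite T" and A: "msym T A"
  shows "hs T (mpow T A k) (mpow T A l) = mtr T (mpow T A (k + l))"
  using assms by (simp add: hs_eq_mtr mtrans_mpow mpow_add)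

lemma mtr_mpow_even_nonneg:
  assumes "finite T" "msym T A"
  shows "0 \<le> mtr T (mpow T A (2 * k))"
  using hs_mpow[OF assms, of k k] hs_nonneg[of T "mpow T A k"] by (simp flip: mult_2)

text \<open>The function \<open>(a, c) \<mapsto> mtr (D P^a D M^c)\<close> is a Gram kernel, hence convex along the
  antidiagonal; this replaces the usual appeal to the spectral theorem.\<close>

lemma mtr_sandwich_le:
  fixes r :: nat
  assumes T: "finite T" and sym: "msym T P" "msym T M" "msym T D" and ac: "a + c = 2 * r"
  shows "\<bar>mtr T (mmul T D (mmul T (mpow T P a) (mmul T D (mpow T M c))))\<bar>
    \<le> hs T (mmul T D (mpow T P r)) (mmul T D (mpow T P r)) + hs T (mmul T D (mpow T M r)) (mmul T D (mpow T M r))"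
proof -
  define F where "F = (\<lambda>a c. mtr T (mmul T D (mmul T (mpow T P a) (mmul T D (mpow T M c)))))"
  define Phi where "Phi = (\<lambda>a c. mmul T (mpow T P a) (mmul T D (mpow T M c)))"
  have Dt: "mmul T X (mtrans D) = mmul T X D" "mmul T (mtrans D) X = mmul T D X" for X
    using sym(3) by (auto intro!: mmul_cong simp: msym_def mtrans_def)
  \<comment> \<open>By symmetry and cyclicity of the trace, inner products of the matrices
    \<open>Phi\<close> depend only on the sums of the exponents. So \<open>F\<close> at two even
    exponents is a squared norm.\<close>
  have gram: "hs T (Phi a c) (Phi a' c') = F (a + a') (c + c')" for a c a' c'
  proof -
    have "hs T (Phi a c) (Phi a' c')
        = mtr T (mmul T (mpow T M c) (mmul T D (mmul T (mpow T P (a + a')) (mmul T D (mpow T M c')))))"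
      using T sym by (simp add: Phi_def hs_eq_mtr mtrans_mmul mtrans_mpow mmul_assoc mpow_add Dt)
    also have "\<dots> = mtr T (mmul T (mmul T D (mmul T (mpow T P (a + a')) (mmul T D (mpow T M c')))) (mpow T M c))"
      by (rule mtr_comm)
    also have "\<dots> = F (a + a') (c' + c)"
      using T by (simp add: F_def mmul_assoc mpow_add)
    finally show ?thesis by (simp add: add.commute)
  qed
  have nonneg: "0 \<le> F (2 * a) (2 * c)" for a c
    using hs_nonneg[of T "Phi a c"] gram[of a c a c] by (simp flip: mult_2)
  have conv: "2 * \<bar>F (a + a') (c + c')\<bar> \<le> F (2 * a) (2 * c) + F (2 * a') (2 * c')" for a a' c c'
    using hs_amgm[of 1 T "Phi a c" "Phi a' c'"] unfolding gram by (simp flip: mult_2)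
  have even: "F (2 * k) (2 * (r - k)) \<le> F 0 (2 * r) + F (2 * r) 0" if "k \<le> r" for k
  proof -
    have "F (2 * k) (2 * (r - k)) \<le> max (F (2 * 0) (2 * (r - 0))) (F (2 * r) (2 * (r - r)))"
    proof (rule discrete_convex_le_max[where g = "\<lambda>k. F (2 * k) (2 * (r - k))", OF _ that])
      fix k assume k: "0 < k" "k < r"
      hence e: "k - 1 + (k + 1) = 2 * k" "r - (k - 1) + (r - (k + 1)) = 2 * (r - k)" by auto
      show "2 * F (2 * k) (2 * (r - k)) \<le> F (2 * (k - 1)) (2 * (r - (k - 1))) + F (2 * (k + 1)) (2 * (r - (k + 1)))"
        using conv[of "k - 1" "k + 1" "r - (k - 1)" "r - (k + 1)"] unfolding e by linarith
    qed
    thus ?thesis using nonneg[of r 0] nonneg[of 0 r] by simp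
  qed
  have "\<bar>F a c\<bar> \<le> F 0 (2 * r) + F (2 * r) 0"
  proof (cases "even a")
    case True
    then obtain k where k: "a = 2 * k" by (elim evenE)
    with ac have c: "k \<le> r" "c = 2 * (r - k)" by auto
    thus ?thesis using even[OF c(1)] nonneg[of k "r - k"] k by simp
  next
    \<comment> \<open>An odd exponent lies between two even neighbours, and AM-GM bounds the mixed
      inner product by their squared norms.\<close>
    case False
    then obtain k where k: "a = 2 * k + 1" by (elim oddE)
    with ac have c: "k + 1 \<le> r" "c = (r - k) + (r - (k + 1))" by auto
    have "2 * \<bar>F a c\<bar> \<le> F (2 * k) (2 * (r - k)) + F (2 * (k + 1)) (2 * (r - (k + 1)))"
      using conv[of k "k + 1" "r - k" "r - (k + 1)"] unfolding k c(2) by (simp only: mult_2 add.assoc)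
    thus ?thesis using even[of k] even[of "k + 1"] c by linarith
  qed
  moreover have "F 0 (2 * r) = hs T (mmul T D (mpow T M r)) (mmul T D (mpow T M r))"
    using gram[of 0 r 0 r] T by (simp add: Phi_def mmul_one_left flip: mult_2)
  moreover have "F (2 * r) 0 = hs T (mmul T D (mpow T P r)) (mmul T D (mpow T P r))"
  proof -
    have "F (2 * r) 0 = mtr T (mmul T (mmul T D (mmul T (mpow T P (2 * r)) D)) (mone T))"
      by (simp add: F_def mmul_assoc)
    also have "\<dots> = mtr T (mmul T (mmul T D (mpow T P r)) (mmul T (mpow T P r) D))"
      by (simp only: mtr_mmul_one[OF T]) (simp only: mult_2 mpow_add[OF T] mmul_assoc)
    also have "\<dots> = mtr T (mmul T (mmul T (mpow T P r) D) (mmul T D (mpow T P r)))"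
      by (rule mtr_comm)
    also have "\<dots> = hs T (mmul T D (mpow T P r)) (mmul T D (mpow T P r))"
      using T sym by (simp add: hs_eq_mtr mtrans_mmul mtrans_mpow Dt)
    finally show ?thesis .
  qed
  ultimately have "\<bar>F a c\<bar> \<le> hs T (mmul T D (mpow T P r)) (mmul T D (mpow T P r)) + hs T (mmul T D (mpow T M r)) (mmul T D (mpow T M r))"
    by linarith
  thus ?thesis unfolding F_def .
qed

text \<open>After division by \<open>c ^ q\<close> the even trace moments are discretely convex in
  \<open>q\<close>, so the one at \<open>p - 1\<close> is controlled by the two ends. The free
  \<open>c\<close> decides how much of the \<open>p\<close>-th one is paid.\<close>

lemma mtr_mpow_interpolate:
  assumes T: "finite T" and A: "msym T A" and c: "c > 0" and p: "p > 0"
  shows "mtr T (mpow T A (2 * (p - 1))) \<le> c ^ (p - 1) * real (card T) + mtr T (mpow T A (2 * p)) / c"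
proof -
  define h where "h = (\<lambda>q. mtr T (mpow T A (2 * q)) / c ^ q)"
  have nonneg: "h q \<ge> 0" for q
    using mtr_mpow_even_nonneg[OF T A, of q] c by (simp add: h_def)
  have "h (p - 1) \<le> max (h 0) (h p)"
  proof (rule discrete_convex_le_max)
    fix q assume q: "0 < q" "q < p"
    have "2 * mtr T (mpow T A (2 * q)) \<le> c * mtr T (mpow T A (2 * (q - 1))) + mtr T (mpow T A (2 * (q + 1))) / c"
    proof -
      have e: "q - 1 + (q + 1) = 2 * q" using q by simp
      show ?thesis
        using hs_amgm[OF c, of T "mpow T A (q - 1)" "mpow T A (q + 1)"]
        unfolding hs_mpow[OF T A] e mult_2[symmetric] by linarith
    qed
    hence "2 * mtr T (mpow T A (2 * q)) / c ^ q \<le>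
        (c * mtr T (mpow T A (2 * (q - 1))) + mtr T (mpow T A (2 * (q + 1))) / c) / c ^ q"
      using c by (intro divide_right_mono) auto
    also have "\<dots> = h (q - 1) + h (q + 1)"
      using q c by (cases q) (simp_all add: h_def add_divide_distrib)
    finally show "2 * h q \<le> h (q - 1) + h (q + 1)" by (simp add: h_def)
  qed simp
  also have "\<dots> \<le> h 0 + h p" using nonneg[of 0] nonneg[of p] by simp
  finally have "h (p - 1) * c ^ (p - 1) \<le> (h 0 + h p) * c ^ (p - 1)"
    using c by (intro mult_right_mono) auto
  also have "h (p - 1) * c ^ (p - 1) = mtr T (mpow T A (2 * (p - 1)))"
    using c by (simp add: h_def)
  also have "(h 0 + h p) * c ^ (p - 1) = c ^ (p - 1) * real (card T) + mtr T (mpow T A (2 * p)) / c"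
    using c p by (cases p) (simp_all add: h_def field_simps)
  finally show ?thesis .
qed

lemma mtr_mpow_odd_le:
  assumes "finite T" "msym T A" "p > 0"
  shows "mtr T (mpow T A (2 * p - 1)) \<le> (mtr T (mpow T A (2 * p)) + mtr T (mpow T A (2 * (p - 1)))) / 2"
proof -
  have "p - 1 + p = 2 * p - 1" using assms by simp
  thus ?thesis
    using hs_amgm[of 1 T "mpow T A (p - 1)" "mpow T A p"]
    unfolding hs_mpow[OF assms(1,2)] mult_2[symmetric] by simp
qed

text \<open>Submultiplicativity of the Frobenius norm, by Cauchy-Schwarz in each entry.\<close>

lemma hs_mmul_le: "hs T (mmul T A X) (mmul T A X) \<le> hs T A A * hs T X X"
proof -
  have "hs T (mmul T A X) (mmul T A X) = (\<Sum>i\<in>T. \<Sum>j\<in>T. (\<Sum>k\<in>T. A i k * X k j)\<^sup>2)"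
    by (simp add: hs_def mmul_def power2_eq_square)
  also have "\<dots> \<le> (\<Sum>i\<in>T. \<Sum>j\<in>T. (\<Sum>k\<in>T. (A i k)\<^sup>2) * (\<Sum>k\<in>T. (X k j)\<^sup>2))"
    by (intro sum_mono Cauchy_Schwarz_ineq_sum)
  also have "\<dots> = (\<Sum>i\<in>T. \<Sum>k\<in>T. (A i k)\<^sup>2) * (\<Sum>j\<in>T. \<Sum>k\<in>T. (X k j)\<^sup>2)"
    by (simp only: sum_product)
  also have "(\<Sum>j\<in>T. \<Sum>k\<in>T. (X k j)\<^sup>2) = (\<Sum>k\<in>T. \<Sum>j\<in>T. (X k j)\<^sup>2)"
    by (rule sum.swap)
  finally show ?thesis by (simp add: hs_def power2_eq_square)
qed

text \<open>The trace bound forces operator norm at most \<open>sqrt d\<close>. No eigenvalues are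
  needed: the squared norms of \<open>A^k X\<close> divided by \<open>d^k\<close> are discretely
  convex in \<open>k\<close>, and the value at \<open>p\<close> is at most the value at
  \<open>0\<close> by \<open>hs_mmul_le\<close>; hence so is the value at \<open>1\<close>.\<close>

lemma hs_mmul_le_of_mtr:
  assumes T: "finite T" and A: "msym T A" and d: "d > 0" and p: "p > 0"
    and tr: "mtr T (mpow T A (2 * p)) \<le> d ^ p"
  shows "hs T (mmul T A X) (mmul T A X) \<le> d * hs T X X"
proof -
  define Z where "Z = (\<lambda>k. mmul T (mpow T A k) X)"
  define h where "h = (\<lambda>k. hs T (Z k) (Z k) / d ^ k)"
  have one: "mmul T (mone T) X i j = X i j" if "i \<in> T" "j \<in> T" for i j
    using T that by (simp add: mmul_def mone_def if_distrib[of "\<lambda>x. x * _"] cong: if_cong)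
  have Z0: "hs T (Z 0) (Z 0) = hs T X X"
    by (simp add: Z_def hs_def one)
  have Z1: "Z 1 = mmul T A X"
    by (simp add: Z_def mmul_assoc) (intro mmul_cong one refl)
  have h1: "h 1 \<le> max (h 0) (h p)"
  proof (rule discrete_convex_le_max)
    fix q assume q: "0 < q" "q < p"
    have "hs T (Z q) (Z q) = hs T (Z (q - 1)) (Z (q + 1))"
    proof -
      have "q - 1 + (q + 1) = q + q" using q by simp
      thus ?thesis unfolding Z_def hs_mmul_mpow[OF T A] by (simp only:)
    qed
    hence "2 * hs T (Z q) (Z q) \<le> d * hs T (Z (q - 1)) (Z (q - 1)) + hs T (Z (q + 1)) (Z (q + 1)) / d"
      using hs_amgm[of d T "Z (q - 1)" "Z (q + 1)"] d by simp
    hence "2 * hs T (Z q) (Z q) / d ^ q \<le>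
        (d * hs T (Z (q - 1)) (Z (q - 1)) + hs T (Z (q + 1)) (Z (q + 1)) / d) / d ^ q"
      using d by (intro divide_right_mono) auto
    also have "\<dots> = h (q - 1) + h (q + 1)"
      using q d by (cases q) (simp_all add: h_def add_divide_distrib)
    finally show "2 * h q \<le> h (q - 1) + h (q + 1)" by (simp add: h_def)
  qed (use p in simp)
  have "h p \<le> h 0"
  proof -
    have "hs T (Z p) (Z p) \<le> mtr T (mpow T A (2 * p)) * hs T X X"
      using hs_mmul_le[of T "mpow T A p" X] by (simp add: Z_def hs_mpow[OF T A] flip: mult_2)
    also have "\<dots> \<le> d ^ p * hs T X X"
      using tr hs_nonneg by (intro mult_right_mono)
    finally show ?thesis using d by (simp add: h_def Z0 field_simps)
  qed
  with h1 have "h 1 \<le> hs T X X" by (simp add: h_def Z0)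
  thus ?thesis using d Z1 by (simp add: h_def field_simps)
qed

section \<open>Trace moments of a matrix-valued Rademacher chaos of order two\<close>

text \<open>The hypothesis \<open>homog\<close> is Euler's identity for a chaos of order two: a
  product of two signs changes by twice its value when either is flipped, which gives 4. It
  expresses one factor of \<open>G^(2p)\<close> through the increments \<open>H\<close>; their
  antisymmetry under the flip then yields a difference of powers, and so a second factor
  \<open>H\<close>.\<close>

lemma chaos_mtr_moment_le:
  fixes G :: "('i \<Rightarrow> real) \<Rightarrow> 'a matr"
  assumes I: "finite I" and T: "finite T" and p: "p > 0"
    and sym: "\<And>b. b \<in> cube I \<Longrightarrow> msym T (G b)"
    and homog: "\<And>b i j. b \<in> cube I \<Longrightarrow> i \<in> T \<Longrightarrow> j \<in> T \<Longrightarrow>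
      (\<Sum>a\<in>I. G b i j - G (flip a b) i j) = 4 * G b i j"
  defines "H \<equiv> (\<lambda>a b i j. G b i j - G (flip a b) i j)"
  shows "(\<Sum>b\<in>cube I. mtr T (mpow T (G b) (2 * p))) \<le> (2 * real p - 1) / 4 *
    (\<Sum>b\<in>cube I. \<Sum>a\<in>I. hs T (mmul T (H a b) (mpow T (G b) (p - 1))) (mmul T (H a b) (mpow T (G b) (p - 1))))"
proof -
  define n where "n = 2 * p - 1"
  define V where "V = (\<lambda>a b. hs T (mmul T (H a b) (mpow T (G b) (p - 1))) (mmul T (H a b) (mpow T (G b) (p - 1))))"
  have n: "2 * p = Suc n" "n - 1 = 2 * (p - 1)" using p by (auto simp: n_def)
  have H_flip: "H a (flip a b) = (\<lambda>i j. - H a b i j)" for a b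
    by (simp add: H_def)
  have euler: "mtr T (mpow T (G b) (2 * p)) = (\<Sum>a\<in>I. mtr T (mmul T (H a b) (mpow T (G b) n))) / 4"
    if b: "b \<in> cube I" for b
  proof -
    have "(\<Sum>a\<in>I. mtr T (mmul T (H a b) (mpow T (G b) n)))
        = (\<Sum>i\<in>T. \<Sum>k\<in>T. (\<Sum>a\<in>I. H a b i k) * mpow T (G b) n k i)"
      unfolding mtr_def mmul_def
      by (subst sum.swap) (simp add: sum_distrib_right, rule sum.cong, simp, rule sum.swap)
    also have "\<dots> = (\<Sum>i\<in>T. \<Sum>k\<in>T. 4 * G b i k * mpow T (G b) n k i)"
      using homog[OF b] by (simp add: H_def)
    also have "\<dots> = 4 * mtr T (mpow T (G b) (2 * p))"
      by (simp add: n mtr_def mmul_def sum_distrib_left mult.assoc)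
    finally show ?thesis by simp
  qed
  have step: "(\<Sum>b\<in>cube I. mtr T (mmul T (H a b) (mpow T (G b) n))) \<le> real n * (\<Sum>b\<in>cube I. V a b)"
    if a: "a \<in> I" for a
  proof -
    define S where "S = (\<Sum>b\<in>cube I. mtr T (mmul T (H a b) (mpow T (G b) n)))"
    have neg: "mmul T (\<lambda>i j. - X i j) Y = (\<lambda>i j. - mmul T X Y i j)" for X Y
      by (auto simp: mmul_def fun_eq_iff sum_negf)
    have "S = (\<Sum>b\<in>cube I. mtr T (mmul T (H a (flip a b)) (mpow T (G (flip a b)) n)))"
      unfolding S_def by (rule sum_cube_flip[OF a, symmetric])
    also have "\<dots> = - (\<Sum>b\<in>cube I. mtr T (mmul T (H a b) (mpow T (G (flip a b)) n)))"
      by (simp add: H_flip neg mtr_def sum_negf)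
    \<comment> \<open>\<open>H\<close> changes sign under the flip while the average is invariant,
      so two copies of \<open>S\<close> combine into a difference of powers at neighbouring points
      of the cube.\<close>
    finally have "2 * S = (\<Sum>b\<in>cube I. mtr T (mmul T (H a b) (mpow T (G b) n)) - mtr T (mmul T (H a b) (mpow T (G (flip a b)) n)))"
      by (simp add: S_def sum_subtractf)
    also have "\<dots> \<le> (\<Sum>b\<in>cube I. real n * (V a b + V a (flip a b)))"
    proof (intro sum_mono)
      fix b assume b: "b \<in> cube I"
      have fb: "flip a b \<in> cube I" using a b by (rule flip_in_cube)
      have symH: "msym T (H a b)" using sym[OF b] sym[OF fb] by (simp add: msym_def H_def)
      have V': "V a (flip a b) = hs T (mmul T (H a b) (mpow T (G (flip a b)) (p - 1))) (mmul T (H a b) (mpow T (G (flip a b)) (p - 1)))"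
        by (simp add: V_def H_flip neg hs_def)
      have "mtr T (mmul T (H a b) (mpow T (G b) n)) - mtr T (mmul T (H a b) (mpow T (G (flip a b)) n))
          = (\<Sum>q<n. mtr T (mmul T (H a b) (mmul T (mpow T (G b) q) (mmul T (H a b) (mpow T (G (flip a b)) (n - Suc q))))))"
        by (rule mtr_telescope[OF T]) (simp add: H_def)
      \<comment> \<open>In each of the \<open>2 * p - 1\<close> telescoping terms the two exponents
        sum to \<open>2 * (p - 1)\<close>, so the same sandwich bound applies to all of
        them.\<close>
      also have "\<dots> \<le> (\<Sum>q<n. V a b + V a (flip a b))"
      proof (intro sum_mono)
        fix q assume "q \<in> {..<n}"
        hence "q + (n - Suc q) = 2 * (p - 1)" using n by auto
        from mtr_sandwich_le[OF T sym[OF b] sym[OF fb] symH this]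
        show "mtr T (mmul T (H a b) (mmul T (mpow T (G b) q) (mmul T (H a b) (mpow T (G (flip a b)) (n - Suc q)))))
            \<le> V a b + V a (flip a b)"
          unfolding V' unfolding V_def by linarith
      qed
      finally show "mtr T (mmul T (H a b) (mpow T (G b) n)) - mtr T (mmul T (H a b) (mpow T (G (flip a b)) n))
          \<le> real n * (V a b + V a (flip a b))" by simp
    qed
    also have "\<dots> = real n * ((\<Sum>b\<in>cube I. V a b) + (\<Sum>b\<in>cube I. V a (flip a b)))"
      by (simp add: distrib_left sum.distrib flip: sum_distrib_left)
    also have "(\<Sum>b\<in>cube I. V a (flip a b)) = (\<Sum>b\<in>cube I. V a b)"
      by (rule sum_cube_flip[OF a])
    finally show ?thesis by (simp add: S_def)
  qed
  have "(\<Sum>b\<in>cube I. mtr T (mpow T (G b) (2 * p))) = (\<Sum>b\<in>cube I. \<Sum>a\<in>I. mtr T (mmul T (H a b) (mpow T (G b) n))) / 4"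
    by (simp add: euler sum_divide_distrib)
  also have "\<dots> = (\<Sum>a\<in>I. \<Sum>b\<in>cube I. mtr T (mmul T (H a b) (mpow T (G b) n))) / 4"
    by (subst sum.swap) simp
  also have "\<dots> \<le> (\<Sum>a\<in>I. real n * (\<Sum>b\<in>cube I. V a b)) / 4"
    by (intro divide_right_mono sum_mono step) auto
  also have "\<dots> = real n / 4 * (\<Sum>a\<in>I. \<Sum>b\<in>cube I. V a b)"
    by (simp flip: sum_distrib_left)
  also have "(\<Sum>a\<in>I. \<Sum>b\<in>cube I. V a b) = (\<Sum>b\<in>cube I. \<Sum>a\<in>I. V a b)"
    by (rule sum.swap)
  also have "real n = 2 * real p - 1" using p by (simp add: n_def of_nat_diff)
  finally show ?thesis by (simp add: V_def)
qed

section \<open>Circulant indices and the discrete Fourier transform\<close>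

definition idx :: "nat \<Rightarrow> nat \<Rightarrow> nat \<Rightarrow> nat" where
  "idx N j i = nat ((int j - int i) mod int N)"

lemma idx_less: "N > 0 \<Longrightarrow> idx N j i < N"
  by (simp add: idx_def nat_less_iff)

lemma int_idx: "N > 0 \<Longrightarrow> int (idx N j i) = (int j - int i) mod int N"
  by (simp add: idx_def)

text \<open>The reflection \<open>j - i\<close> modulo \<open>N\<close> is its own inverse; this
  yields injectivity and the later passage from rows to signs.\<close>

lemma idx_idx:
  assumes "i < N"
  shows "idx N j (idx N j i) = i"
proof -
  have "int (idx N j (idx N j i)) = (int j - (int j - int i) mod int N) mod int N"
    using assms by (simp add: int_idx)
  also have "\<dots> = int i mod int N" by (simp add: mod_diff_right_eq)
  finally show ?thesis using assms by simp
qed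

lemma inj_on_idx: "S \<subseteq> {..<N} \<Longrightarrow> inj_on (idx N j) S"
  by (rule inj_on_inverseI[of _ "idx N j"]) (auto simp: idx_idx)

text \<open>In every row, distinct columns carry distinct entries of \<open>b\<close>; hence
  off-diagonal Gram entries contain no squares of signs.\<close>

lemma idx_eq_iff:
  assumes "k < N" "l < N"
  shows "idx N k i = idx N l i \<longleftrightarrow> k = l"
proof
  assume "idx N k i = idx N l i"
  hence "(int k - int i) mod int N = (int l - int i) mod int N"
    using assms by (metis int_idx gr_implies_not0 not_gr_zero)
  hence "(int k - int i + int i) mod int N = (int l - int i + int i) mod int N"
    by (rule mod_add_cong) simp
  thus "k = l" using assms by simp
qed simp

text \<open>The first argument is an integer so that conjugates and negative shifts are again
  characters; the second is the frequency.\<close>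

definition dft_char :: "nat \<Rightarrow> int \<Rightarrow> nat \<Rightarrow> complex" where
  "dft_char N x j = cis (2 * pi * real_of_int x * real j / real N)"

lemma dft_char_add: "dft_char N (x + y) j = dft_char N x j * dft_char N y j"
  by (simp add: dft_char_def cis_mult add_divide_distrib algebra_simps)

lemma cnj_dft_char: "cnj (dft_char N x j) = dft_char N (- x) j"
  by (simp add: dft_char_def cis_cnj)

lemma dft_char_multiple:
  assumes "N > 0"
  shows "dft_char N (int N * k) j = 1"
proof -
  have "dft_char N (int N * k) j = cis (2 * pi * real_of_int (k * int j))"
    using assms by (simp add: dft_char_def mult_ac)
  also have "\<dots> = 1" by (rule cis_multiple_2pi) simp
  finally show ?thesis .
qed

lemma dft_char_mod:
  assumes "N > 0"
  shows "dft_char N (x mod int N) j = dft_char N x j"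
proof -
  have "dft_char N x j = dft_char N (int N * (x div int N) + x mod int N) j" by simp
  also have "\<dots> = dft_char N (x mod int N) j"
    unfolding dft_char_add using assms by (simp add: dft_char_multiple)
  finally show ?thesis by simp
qed

lemma dft_char_power: "dft_char N x j = dft_char N x 1 ^ j"
proof -
  have "dft_char N x 1 ^ j = cis (real j * (2 * pi * real_of_int x * real 1 / real N))"
    unfolding dft_char_def by (rule Complex.DeMoivre)
  also have "real j * (2 * pi * real_of_int x * real 1 / real N) = 2 * pi * real_of_int x * real j / real N"
    by simp
  finally show ?thesis by (simp add: dft_char_def)
qed

text \<open>For \<open>a \<noteq> a'\<close> this is a geometric sum over an \<open>N\<close>-th
  root of unity, which differs from 1 because \<open>a\<close> and \<open>a'\<close> differ by less
  than \<open>N\<close>.\<close>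

lemma sum_dft_char:
  assumes "a < N" "a' < N"
  shows "(\<Sum>j<N. dft_char N (int a - int a') j) = (if a = a' then of_nat N else 0)"
proof (cases "a = a'")
  case True
  thus ?thesis by (simp add: dft_char_def)
next
  case False
  define z where "z = dft_char N (int a - int a') 1"
  have "z ^ N = dft_char N (int a - int a') N"
    using dft_char_power[of N "int a - int a'" N] by (simp add: z_def)
  also have "\<dots> = cis (2 * pi * real_of_int (int a - int a'))"
    using assms by (simp add: dft_char_def)
  also have "\<dots> = 1" by (rule cis_multiple_2pi) auto
  finally have zN: "z ^ N = 1" .
  have "z \<noteq> 1"
  proof
    assume "z = 1"
    hence "cos (2 * pi * real_of_int (int a - int a') * real 1 / real N) = 1"
      unfolding z_def dft_char_def by (metis cis.sel(1) one_complex.sel(1))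
    then obtain m :: int where "2 * pi * real_of_int (int a - int a') * real 1 / real N = real_of_int m * 2 * pi"
      unfolding cos_one_2pi_int by blast
    hence "2 * pi * (real_of_int (int a - int a') / real N) = 2 * pi * real_of_int m"
      by (simp add: mult_ac)
    hence "real_of_int (int a - int a') / real N = real_of_int m"
      by (subst (asm) mult_left_cancel) auto
    hence "real_of_int (int a - int a') = real_of_int (m * int N)"
      using assms by (simp add: field_simps)
    hence "int a - int a' = m * int N" by (simp only: of_int_eq_iff)
    moreover have "\<bar>int a - int a'\<bar> < int N" using assms by auto
    ultimately have "\<bar>m\<bar> * int N < 1 * int N" by (simp add: abs_mult)
    hence "m = 0" by (simp only: mult_less_cancel_right) auto
    with \<open>int a - int a' = m * int N\<close> False show False by simp
  qed
  hence "(\<Sum>j<N. z ^ j) = 0" by (simp add: geometric_sum zN)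
  hence "(\<Sum>j<N. dft_char N (int a - int a') j) = 0"
    by (subst dft_char_power) (simp add: z_def)
  thus ?thesis using False by simp
qed

lemma dft_parseval:
  fixes c :: "nat \<Rightarrow> real"
  assumes "N > 0"
  shows "(\<Sum>j<N. (cmod (\<Sum>a<N. of_real (c a) * dft_char N (int a) j))\<^sup>2) = real N * (\<Sum>a<N. (c a)\<^sup>2)"
proof -
  have "complex_of_real (\<Sum>j<N. (cmod (\<Sum>a<N. of_real (c a) * dft_char N (int a) j))\<^sup>2)
      = (\<Sum>j<N. \<Sum>a<N. \<Sum>a'<N. of_real (c a * c a') * dft_char N (int a - int a') j)"
  proof -
    have "complex_of_real ((cmod (\<Sum>a<N. of_real (c a) * dft_char N (int a) j))\<^sup>2)
        = (\<Sum>a<N. \<Sum>a'<N. of_real (c a * c a') * dft_char N (int a - int a') j)" for j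
      unfolding complex_norm_square cnj_sum sum_product
      by (intro sum.cong refl) (simp add: cnj_dft_char mult_ac flip: dft_char_add)
    thus ?thesis by (simp only: of_real_sum)
  qed
  also have "\<dots> = (\<Sum>a<N. \<Sum>a'<N. of_real (c a * c a') * (\<Sum>j<N. dft_char N (int a - int a') j))"
    unfolding sum_distrib_left by (subst sum.swap, rule sum.cong[OF refl], rule sum.swap)
  also have "\<dots> = (\<Sum>a<N. \<Sum>a'<N. if a' = a then of_real (c a * c a) * of_nat N else 0)"
    by (intro sum.cong refl) (auto simp: sum_dft_char)
  also have "\<dots> = complex_of_real (real N * (\<Sum>a<N. (c a)\<^sup>2))"
    by (simp add: sum_distrib_left sum_distrib_right power2_eq_square mult_ac)
  finally show ?thesis by (simp only: of_real_eq_iff)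
qed

text \<open>The inner double sum is the circular convolution of \<open>y\<close> on \<open>T\<close>
  with the reflection of \<open>g\<close> on \<open>\<Omega>\<close>. Its transform is a product;
  bounding one factor by \<open>K\<close> and using Parseval in both directions cancels the factor
  \<open>N\<close>.\<close>

lemma circular_convolution_le:
  fixes y g :: "nat \<Rightarrow> real"
  assumes N: "N > 0" and T: "T \<subseteq> {..<N}" and Om: "finite \<Omega>"
    and K: "\<And>j. j < N \<Longrightarrow> (cmod (\<Sum>i\<in>\<Omega>. of_real (g i) * dft_char N (- int i) j))\<^sup>2 \<le> K"
  shows "(\<Sum>a<N. (\<Sum>l\<in>T. \<Sum>i\<in>\<Omega>. if idx N l i = a then y l * g i else 0)\<^sup>2) \<le> K * (\<Sum>l\<in>T. (y l)\<^sup>2)"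
proof -
  define c where "c = (\<lambda>a. \<Sum>l\<in>T. \<Sum>i\<in>\<Omega>. if idx N l i = a then y l * g i else 0)"
  define y' where "y' = (\<lambda>l. if l \<in> T then y l else 0)"
  have T': "finite T" "{..<N} \<inter> T = T" using T finite_subset by auto
  have conv: "(\<Sum>a<N. of_real (c a) * dft_char N (int a) j) =
      (\<Sum>l<N. of_real (y' l) * dft_char N (int l) j) * (\<Sum>i\<in>\<Omega>. of_real (g i) * dft_char N (- int i) j)" for j
  proof -
    have "(\<Sum>a<N. of_real (c a) * dft_char N (int a) j) =
       (\<Sum>a<N. \<Sum>l\<in>T. \<Sum>i\<in>\<Omega>. if idx N l i = a then of_real (y l * g i) * dft_char N (int a) j else 0)"
      by (intro sum.cong refl) (auto simp: c_def sum_distrib_right intro!: sum.cong)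
    also have "\<dots> = (\<Sum>l\<in>T. \<Sum>i\<in>\<Omega>. \<Sum>a<N. if idx N l i = a then of_real (y l * g i) * dft_char N (int a) j else 0)"
      by (subst sum.swap, rule sum.cong[OF refl], rule sum.swap)
    also have "\<dots> = (\<Sum>l\<in>T. \<Sum>i\<in>\<Omega>. of_real (y l * g i) * dft_char N (int (idx N l i)) j)"
      using N by (simp add: idx_less)
    also have "\<dots> = (\<Sum>l\<in>T. \<Sum>i\<in>\<Omega>. (of_real (y l) * dft_char N (int l) j) * (of_real (g i) * dft_char N (- int i) j))"
    proof (intro sum.cong refl)
      fix l i
      have "dft_char N (int (idx N l i)) j = dft_char N (int l) j * dft_char N (- int i) j"
        using N dft_char_add[of N "int l" "- int i" j] by (simp add: int_idx dft_char_mod)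
      thus "complex_of_real (y l * g i) * dft_char N (int (idx N l i)) j
          = (of_real (y l) * dft_char N (int l) j) * (of_real (g i) * dft_char N (- int i) j)" by simp
    qed
    also have "\<dots> = (\<Sum>l\<in>T. of_real (y l) * dft_char N (int l) j) * (\<Sum>i\<in>\<Omega>. of_real (g i) * dft_char N (- int i) j)"
      by (simp add: sum_product)
    also have "(\<Sum>l\<in>T. of_real (y l) * dft_char N (int l) j) = (\<Sum>l<N. of_real (y' l) * dft_char N (int l) j)"
      using T' by (intro sum.mono_neutral_cong_left) (use T in \<open>auto simp: y'_def\<close>)
    finally show ?thesis .
  qed
  have "real N * (\<Sum>a<N. (c a)\<^sup>2) = (\<Sum>j<N. (cmod (\<Sum>a<N. of_real (c a) * dft_char N (int a) j))\<^sup>2)"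
    using N by (simp add: dft_parseval)
  also have "\<dots> \<le> (\<Sum>j<N. K * (cmod (\<Sum>l<N. of_real (y' l) * dft_char N (int l) j))\<^sup>2)"
    unfolding conv norm_mult power_mult_distrib
    by (intro sum_mono, subst mult.commute, intro mult_right_mono K) auto
  also have "\<dots> = K * (real N * (\<Sum>l<N. (y' l)\<^sup>2))"
    using N by (simp add: dft_parseval flip: sum_distrib_left)
  also have "(\<Sum>l<N. (y' l)\<^sup>2) = (\<Sum>l\<in>T. (y l)\<^sup>2)"
    using T' by (intro sum.mono_neutral_cong_right) (use T in \<open>auto simp: y'_def\<close>)
  finally have "real N * (\<Sum>a<N. (c a)\<^sup>2) \<le> real N * (K * (\<Sum>l\<in>T. (y l)\<^sup>2))"
    by (simp add: mult_ac)
  thus ?thesis using N by (simp add: c_def)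
qed

text \<open>Since \<open>idx N t\<close> is injective on \<open>\<Omega>\<close>, the sum is a
  Rademacher sum; \<open>c\<close> lists its coefficients by sign instead of by row.\<close>

lemma circulant_moment_le:
  fixes w :: "nat \<Rightarrow> real"
  assumes Om: "\<Omega> \<subseteq> {..<N}" "\<Omega> \<noteq> {}" and w: "\<And>i. \<bar>w i\<bar> \<le> 1" and p: "p > 0"
  shows "(\<Sum>b\<in>cube {..<N}. (\<Sum>i\<in>\<Omega>. b (idx N t i) * w i) ^ (2 * p)) \<le> 2 ^ N * (2 * (6 * real p * real (card \<Omega>)) ^ p)"
proof -
  define c where "c = (\<lambda>a. if idx N t a \<in> \<Omega> then w (idx N t a) else 0)"
  have fin: "finite \<Omega>" and N: "N > 0" using Om finite_subset by auto
  have reindex: "(\<Sum>a<N. if idx N t a \<in> \<Omega> then f (idx N t a) a else 0) = (\<Sum>i\<in>\<Omega>. f i (idx N t i))" for f :: "nat \<Rightarrow> nat \<Rightarrow> real"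
    by (subst sum.inter_filter[symmetric], simp,
        rule sum.reindex_bij_witness[of _ "idx N t" "idx N t"])
      (use Om N in \<open>auto simp: idx_idx idx_less\<close>)
  have "(\<Sum>i\<in>\<Omega>. b (idx N t i) * w i) = (\<Sum>a<N. c a * b a)" for b
    using reindex[of "\<lambda>i a. w i * b a"] by (simp add: c_def mult_ac if_distrib[of "\<lambda>x. _ * x"] cong: if_cong)
  moreover have "(\<Sum>a<N. (c a)\<^sup>2) \<le> real (card \<Omega>)"
  proof -
    have "(\<Sum>a<N. (c a)\<^sup>2) = (\<Sum>i\<in>\<Omega>. (w i)\<^sup>2)"
      using reindex[of "\<lambda>i a. (w i)\<^sup>2"] by (simp add: c_def if_distrib[of "\<lambda>x. x\<^sup>2"] cong: if_cong)
    also have "\<dots> \<le> (\<Sum>i\<in>\<Omega>. 1)" by (intro sum_mono) (simp add: abs_square_le_1 w)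
    finally show ?thesis by simp
  qed
  moreover have "real (card \<Omega>) > 0" using Om fin by (simp add: card_gt_0_iff)
  ultimately show ?thesis using cube_moment_le[of "{..<N}" "real (card \<Omega>)" c p] p by simp
qed

section \<open>The largest Fourier coefficient and its moments\<close>

definition spectral_peak :: "nat \<Rightarrow> nat set \<Rightarrow> (nat \<Rightarrow> real) \<Rightarrow> real" where
  "spectral_peak N \<Omega> b = Max ((\<lambda>(t, j). (cmod (\<Sum>i\<in>\<Omega>. of_real (b (idx N t i)) * dft_char N (- int i) j))\<^sup>2) ` ({..<N} \<times> {..<N}))"

lemma spectral_peak_ge:
  assumes "t < N" "j < N"
  shows "(cmod (\<Sum>i\<in>\<Omega>. of_real (b (idx N t i)) * dft_char N (- int i) j))\<^sup>2 \<le> spectral_peak N \<Omega> b"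
  unfolding spectral_peak_def using assms by (intro Max_ge) auto

lemma spectral_peak_attained:
  assumes "N > 0"
  obtains t j where "t < N" "j < N"
    "spectral_peak N \<Omega> b = (cmod (\<Sum>i\<in>\<Omega>. of_real (b (idx N t i)) * dft_char N (- int i) j))\<^sup>2"
proof -
  have "spectral_peak N \<Omega> b \<in> (\<lambda>(t, j). (cmod (\<Sum>i\<in>\<Omega>. of_real (b (idx N t i)) * dft_char N (- int i) j))\<^sup>2) ` ({..<N} \<times> {..<N})"
    unfolding spectral_peak_def using assms by (intro Max_in) auto
  thus ?thesis using that by auto
qed

lemma add_power_le:
  fixes x y :: real
  assumes "x \<ge> 0" "y \<ge> 0"
  shows "(x + y) ^ p \<le> 2 ^ p * (x ^ p + y ^ p)"
proof -
  have "(x + y) ^ p \<le> (2 * max x y) ^ p" using assms by (intro power_mono) auto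
  also have "\<dots> = 2 ^ p * max x y ^ p" by (simp add: power_mult_distrib)
  also have "max x y ^ p \<le> x ^ p + y ^ p" using assms by (simp add: max_def)
  finally show ?thesis by simp
qed

text \<open>The maximum is dominated by the sum over all \<open>N^2\<close> pairs. Splitting each
  coefficient into cosine and sine parts costs \<open>2 ^ p\<close> and two moments, which turns the
  constants 6 and 2 of \<open>cube_moment_le\<close> into 12 and 4.\<close>

lemma spectral_peak_moment_le:
  assumes Om: "\<Omega> \<subseteq> {..<N}" "\<Omega> \<noteq> {}" and p: "p > 0"
  shows "(\<Sum>b\<in>cube {..<N}. spectral_peak N \<Omega> b ^ p) \<le> 2 ^ N * (4 * (real N)\<^sup>2 * (12 * real p * real (card \<Omega>)) ^ p)"
proof -
  have N: "N > 0" using Om by auto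
  define u where "u = (\<lambda>t j b. \<Sum>i\<in>\<Omega>. b (idx N t i) * cos (2 * pi * real i * real j / real N))"
  define v where "v = (\<lambda>t j b. \<Sum>i\<in>\<Omega>. b (idx N t i) * sin (2 * pi * real i * real j / real N))"
  have uv: "(cmod (\<Sum>i\<in>\<Omega>. of_real (b (idx N t i)) * dft_char N (- int i) j))\<^sup>2 = (u t j b)\<^sup>2 + (v t j b)\<^sup>2" for t j b
    by (simp add: cmod_power2 u_def v_def dft_char_def sum_negf)
  have "spectral_peak N \<Omega> b ^ p \<le> (\<Sum>t<N. \<Sum>j<N. 2 ^ p * (u t j b ^ (2 * p) + v t j b ^ (2 * p)))" for b
  proof -
    obtain t j where tj: "t < N" "j < N" "spectral_peak N \<Omega> b = (u t j b)\<^sup>2 + (v t j b)\<^sup>2"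
      using spectral_peak_attained[OF N, of \<Omega> b] unfolding uv by metis
    have "spectral_peak N \<Omega> b ^ p \<le> 2 ^ p * (u t j b ^ (2 * p) + v t j b ^ (2 * p))"
      unfolding tj(3) power_mult by (rule add_power_le) auto
    also have "\<dots> \<le> (\<Sum>j<N. 2 ^ p * (u t j b ^ (2 * p) + v t j b ^ (2 * p)))"
      using tj by (intro member_le_sum) (auto simp: power_mult)
    also have "\<dots> \<le> (\<Sum>t<N. \<Sum>j<N. 2 ^ p * (u t j b ^ (2 * p) + v t j b ^ (2 * p)))"
      using tj by (intro member_le_sum[of t "{..<N}" "\<lambda>t. \<Sum>j<N. 2 ^ p * (u t j b ^ (2 * p) + v t j b ^ (2 * p))"])
        (auto simp: power_mult intro!: sum_nonneg)
    finally show ?thesis .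
  qed
  hence "(\<Sum>b\<in>cube {..<N}. spectral_peak N \<Omega> b ^ p)
      \<le> (\<Sum>b\<in>cube {..<N}. \<Sum>t<N. \<Sum>j<N. 2 ^ p * (u t j b ^ (2 * p) + v t j b ^ (2 * p)))"
    by (rule sum_mono)
  also have "\<dots> = (\<Sum>t<N. \<Sum>j<N. \<Sum>b\<in>cube {..<N}. 2 ^ p * (u t j b ^ (2 * p) + v t j b ^ (2 * p)))"
    by (subst sum.swap, rule sum.cong[OF refl], rule sum.swap)
  also have "\<dots> = (\<Sum>t<N. \<Sum>j<N. 2 ^ p * ((\<Sum>b\<in>cube {..<N}. u t j b ^ (2 * p)) + (\<Sum>b\<in>cube {..<N}. v t j b ^ (2 * p))))"
    by (simp add: sum.distrib flip: sum_distrib_left)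
  also have "\<dots> \<le> (\<Sum>t<N. \<Sum>j<N. 2 ^ p * (2 ^ N * (2 * (6 * real p * real (card \<Omega>)) ^ p) + 2 ^ N * (2 * (6 * real p * real (card \<Omega>)) ^ p)))"
    unfolding u_def v_def by (intro sum_mono mult_left_mono add_mono circulant_moment_le Om p) auto
  also have "\<dots> = 2 ^ N * (4 * (real N)\<^sup>2 * (2 ^ p * (6 * real p * real (card \<Omega>)) ^ p))"
    by (simp add: power2_eq_square)
  also have "2 ^ p * (6 * real p * real (card \<Omega>)) ^ p = (12 * real p * real (card \<Omega>)) ^ p"
    by (simp add: mult_ac flip: power_mult_distrib)
  finally show ?thesis .
qed

section \<open>The Gram matrix of a partial random circulant matrix\<close>

text \<open>The normalised Gram matrix of the columns minus the identity: sign columns have diagonal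
  entries 1. Setting the diagonal to 0 directly keeps every entry a homogeneous quadratic form in
  \<open>b\<close>.\<close>

definition gram :: "nat \<Rightarrow> nat set \<Rightarrow> (nat \<Rightarrow> real) \<Rightarrow> nat matr" where
  "gram N \<Omega> b k l = (if k = l then 0 else (\<Sum>i\<in>\<Omega>. b (idx N k i) * b (idx N l i)) / real (card \<Omega>))"

lemma gram_sym: "gram N \<Omega> b k l = gram N \<Omega> b l k"
  by (simp add: gram_def mult.commute)

lemma msym_gram: "msym T (gram N \<Omega> b)"
  by (simp add: msym_def gram_sym[of N \<Omega> b])

lemma flip_product_diff:
  assumes "x \<noteq> y"
  shows "b x * b y - flip a b x * flip a b y = 2 * (if x = a then b x * b y else 0) + 2 * (if y = a then b x * b y else 0)"
  using assms by (auto simp: flip_def)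

lemma gram_homogeneous:
  assumes "k < N" "l < N"
  shows "(\<Sum>a<N. gram N \<Omega> b k l - gram N \<Omega> (flip a b) k l) = 4 * gram N \<Omega> b k l"
proof (cases "k = l")
  case True
  thus ?thesis by (simp add: gram_def)
next
  case False
  have N: "N > 0" using assms by simp
  have "(\<Sum>a<N. gram N \<Omega> b k l - gram N \<Omega> (flip a b) k l)
      = (\<Sum>a<N. (\<Sum>i\<in>\<Omega>. b (idx N k i) * b (idx N l i) - flip a b (idx N k i) * flip a b (idx N l i))) / real (card \<Omega>)"
    using False by (simp add: gram_def sum_subtractf diff_divide_distrib flip: sum_divide_distrib)
  also have "(\<Sum>a<N. (\<Sum>i\<in>\<Omega>. b (idx N k i) * b (idx N l i) - flip a b (idx N k i) * flip a b (idx N l i)))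
      = (\<Sum>i\<in>\<Omega>. \<Sum>a<N. b (idx N k i) * b (idx N l i) - flip a b (idx N k i) * flip a b (idx N l i))"
    by (rule sum.swap)
  also have "\<dots> = (\<Sum>i\<in>\<Omega>. 4 * (b (idx N k i) * b (idx N l i)))"
  proof (intro sum.cong refl)
    fix i
    have "idx N k i \<noteq> idx N l i" using False assms by (simp add: idx_eq_iff)
    hence "(\<Sum>a<N. b (idx N k i) * b (idx N l i) - flip a b (idx N k i) * flip a b (idx N l i)) =
      (\<Sum>a<N. 2 * (if idx N k i = a then b (idx N k i) * b (idx N l i) else 0) + 2 * (if idx N l i = a then b (idx N k i) * b (idx N l i) else 0))"
      by (intro sum.cong refl flip_product_diff)
    also have "\<dots> = 4 * (b (idx N k i) * b (idx N l i))"
      using N by (simp add: sum.distrib idx_less flip: sum_distrib_left)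
    finally show "(\<Sum>a<N. b (idx N k i) * b (idx N l i) - flip a b (idx N k i) * flip a b (idx N l i)) = 4 * (b (idx N k i) * b (idx N l i))" .
  qed
  finally show ?thesis using False by (simp add: gram_def sum_distrib_left)
qed

text \<open>By injectivity each inner sum has at most one nonzero term, so squaring creates no cross
  terms.\<close>

lemma sum_square_fibres:
  fixes f :: "'a \<Rightarrow> real"
  assumes "finite A" "finite S" "inj_on \<phi> S" "\<phi> ` S \<subseteq> A"
  shows "(\<Sum>a\<in>A. (\<Sum>i\<in>S. if \<phi> i = a then f i else 0)\<^sup>2) = (\<Sum>i\<in>S. (f i)\<^sup>2)"
proof -
  have hit: "(\<Sum>i\<in>S. if \<phi> i = \<phi> j then f i else 0) = f j" if "j \<in> S" for j
  proof -
    have "(\<Sum>i\<in>S. if \<phi> i = \<phi> j then f i else 0) = (\<Sum>i\<in>S. if i = j then f i else 0)"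
      using assms(3) that by (intro sum.cong) (auto simp: inj_on_eq_iff)
    thus ?thesis using that assms(2) by simp
  qed
  have "(\<Sum>a\<in>A. (\<Sum>i\<in>S. if \<phi> i = a then f i else 0)\<^sup>2) = (\<Sum>a\<in>\<phi> ` S. (\<Sum>i\<in>S. if \<phi> i = a then f i else 0)\<^sup>2)"
    using assms by (intro sum.mono_neutral_right) (auto intro!: sum.neutral)
  also have "\<dots> = (\<Sum>j\<in>S. (\<Sum>i\<in>S. if \<phi> i = \<phi> j then f i else 0)\<^sup>2)"
    using assms(3) by (simp add: sum.reindex)
  finally show ?thesis by (simp add: hit)
qed

text \<open>Cauchy-Schwarz for three summands, with the deficit written as a sum of squares.\<close>

lemma square_combination_le:
  fixes u z w :: real
  shows "(2 * u + 2 * z - 4 * w)\<^sup>2 \<le> 12 * (u\<^sup>2 + z\<^sup>2 + 4 * w\<^sup>2)"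
proof -
  have "12 * (u\<^sup>2 + z\<^sup>2 + 4 * w\<^sup>2) - (2 * u + 2 * z - 4 * w)\<^sup>2
      = 4 * ((u - z)\<^sup>2 + (u + 2 * w)\<^sup>2 + (z + 2 * w)\<^sup>2)"
    by (simp add: power2_eq_square algebra_simps)
  also have "\<dots> \<ge> 0" by simp
  finally show ?thesis by simp
qed

text \<open>Flipping \<open>b a\<close> matters in a row where \<open>a\<close> sits in column
  \<open>k\<close> or in column \<open>l\<close>, which gives the first two terms. The third removes
  their contribution at \<open>l = k\<close>, where the Gram entry is constantly 0 and the signs
  multiply to 1.\<close>

lemma gram_variation_eq:
  assumes T: "T \<subseteq> {..<N}" and b: "b \<in> cube {..<N}" and Om: "\<Omega> \<subseteq> {..<N}" "\<Omega> \<noteq> {}" and a: "a < N" and k: "k \<in> T"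
  shows "real (card \<Omega>) * (\<Sum>l\<in>T. (gram N \<Omega> b k l - gram N \<Omega> (flip a b) k l) * y l) =
      2 * (\<Sum>i\<in>\<Omega>. if idx N k i = a then b (idx N k i) * (\<Sum>l\<in>T. b (idx N l i) * y l) else 0)
    + 2 * (b a * (\<Sum>l\<in>T. \<Sum>i\<in>\<Omega>. if idx N l i = a then y l * b (idx N k i) else 0))
    - 4 * (\<Sum>i\<in>\<Omega>. if idx N k i = a then y k else 0)" (is "?L = ?R")
proof -
  have fin: "finite T" "finite \<Omega>" using T Om finite_subset by auto
  have N: "N > 0" using a by simp
  have n: "real (card \<Omega>) > 0" using Om fin by (simp add: card_gt_0_iff)
  have bb: "b (idx N j i) * b (idx N j i) = 1" for j i
    using b N by (intro cube_square[of _ "{..<N}"]) (auto simp: idx_less)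
  define e where "e = (\<lambda>l. \<Sum>i\<in>\<Omega>. 2 * (if idx N k i = a then b (idx N k i) * b (idx N l i) else 0)
        + 2 * (if idx N l i = a then b (idx N k i) * b (idx N l i) else 0))"
  have entry: "real (card \<Omega>) * (gram N \<Omega> b k l - gram N \<Omega> (flip a b) k l) = e l - (if l = k then e k else 0)"
    if "l \<in> T" for l
  proof (cases "l = k")
    case True
    thus ?thesis by (simp add: gram_def)
  next
    case False
    have neq: "idx N k i \<noteq> idx N l i" for i
      using False T k that by (subst idx_eq_iff) auto
    have "real (card \<Omega>) * (gram N \<Omega> b k l - gram N \<Omega> (flip a b) k l)
        = (\<Sum>i\<in>\<Omega>. b (idx N k i) * b (idx N l i) - flip a b (idx N k i) * flip a b (idx N l i))"
      using False n by (simp add: gram_def sum_subtractf right_diff_distrib)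
    also have "\<dots> = e l"
      unfolding e_def by (intro sum.cong refl flip_product_diff neq)
    finally show ?thesis using False by simp
  qed
  have "?L = (\<Sum>l\<in>T. (real (card \<Omega>) * (gram N \<Omega> b k l - gram N \<Omega> (flip a b) k l)) * y l)"
    by (simp add: sum_distrib_left mult.assoc)
  also have "\<dots> = (\<Sum>l\<in>T. (e l - (if l = k then e k else 0)) * y l)"
    by (intro sum.cong refl) (simp add: entry)
  also have "\<dots> = (\<Sum>l\<in>T. e l * y l) - e k * y k"
    using k fin by (simp add: left_diff_distrib sum_subtractf if_distrib[of "\<lambda>x. x * _"] cong: if_cong)
  also have "e k * y k = 4 * (\<Sum>i\<in>\<Omega>. if idx N k i = a then y k else 0)"
    unfolding e_def sum_distrib_right sum_distrib_left using bb by (intro sum.cong refl) auto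
  also have "(\<Sum>l\<in>T. e l * y l) =
      2 * (\<Sum>l\<in>T. \<Sum>i\<in>\<Omega>. if idx N k i = a then b (idx N k i) * (b (idx N l i) * y l) else 0)
    + 2 * (\<Sum>l\<in>T. \<Sum>i\<in>\<Omega>. if idx N l i = a then b a * (y l * b (idx N k i)) else 0)"
    unfolding e_def sum_distrib_left sum_distrib_right sum.distrib[symmetric]
    by (intro sum.cong refl) (auto simp: algebra_simps)
  also have "(\<Sum>l\<in>T. \<Sum>i\<in>\<Omega>. if idx N k i = a then b (idx N k i) * (b (idx N l i) * y l) else 0)
      = (\<Sum>i\<in>\<Omega>. if idx N k i = a then b (idx N k i) * (\<Sum>l\<in>T. b (idx N l i) * y l) else 0)"
    by (subst sum.swap) (auto simp: sum_distrib_left intro!: sum.cong)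
  also have "(\<Sum>l\<in>T. \<Sum>i\<in>\<Omega>. if idx N l i = a then b a * (y l * b (idx N k i)) else 0)
      = b a * (\<Sum>l\<in>T. \<Sum>i\<in>\<Omega>. if idx N l i = a then y l * b (idx N k i) else 0)"
    unfolding sum_distrib_left by (intro sum.cong refl) auto
  finally show ?thesis .
qed

text \<open>Summed over \<open>a\<close>, the first term of \<open>gram_variation_eq\<close> becomes
  the squared norm of the measurements of \<open>y\<close>, which is \<open>card \<Omega>\<close>
  times the quadratic form of \<open>gram\<close> plus the squared norm of \<open>y\<close>. The
  second is a convolution bounded by the spectral peak, the third is diagonal. The constant 5 is 1
  from the first plus 4 from the third.\<close>

lemma gram_variation_le:
  assumes T: "T \<subseteq> {..<N}" "T \<noteq> {}" and b: "b \<in> cube {..<N}" and Om: "\<Omega> \<subseteq> {..<N}" "\<Omega> \<noteq> {}"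
  shows "(\<Sum>a<N. \<Sum>k\<in>T. (\<Sum>l\<in>T. (gram N \<Omega> b k l - gram N \<Omega> (flip a b) k l) * y l)\<^sup>2)
    \<le> 12 * real (card T) / real (card \<Omega>) *
       ((\<Sum>k\<in>T. \<Sum>l\<in>T. y k * (gram N \<Omega> b k l * y l)) + (spectral_peak N \<Omega> b / real (card \<Omega>) + 5) * (\<Sum>k\<in>T. (y k)\<^sup>2))"
proof -
  define n where "n = real (card \<Omega>)"
  define d where "d = real (card T)"
  define S where "S = spectral_peak N \<Omega> b"
  define Y where "Y = (\<Sum>k\<in>T. (y k)\<^sup>2)"
  define R where "R = (\<lambda>i. \<Sum>l\<in>T. b (idx N l i) * y l)"
  define U where "U = (\<lambda>a k. \<Sum>i\<in>\<Omega>. if idx N k i = a then b (idx N k i) * R i else 0)"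
  define Z where "Z = (\<lambda>a k. \<Sum>l\<in>T. \<Sum>i\<in>\<Omega>. if idx N l i = a then y l * b (idx N k i) else 0)"
  define W where "W = (\<lambda>a k. \<Sum>i\<in>\<Omega>. if idx N k i = a then y k else 0)"
  define V where "V = (\<lambda>a k. \<Sum>l\<in>T. (gram N \<Omega> b k l - gram N \<Omega> (flip a b) k l) * y l)"
  have fin: "finite T" "finite \<Omega>" using T Om finite_subset by auto
  have N: "N > 0" using T by auto
  have n: "n > 0" using Om fin by (simp add: n_def card_gt_0_iff)
  have d: "d \<ge> 1" using T fin by (simp add: d_def Suc_le_eq card_gt_0_iff)
  have bb: "b (idx N j i) * b (idx N j i) = 1" for j i
    using b N by (intro cube_square[of _ "{..<N}"]) (auto simp: idx_less)
  have pt: "(n * V a k)\<^sup>2 \<le> 12 * ((U a k)\<^sup>2 + (Z a k)\<^sup>2 + 4 * (W a k)\<^sup>2)" if "a < N" "k \<in> T" for a k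
  proof -
    have "n * V a k = 2 * U a k + 2 * (b a * Z a k) - 4 * W a k"
      unfolding n_def V_def U_def Z_def W_def R_def
      by (rule gram_variation_eq[OF T(1) b Om that])
    moreover have "(b a * Z a k)\<^sup>2 = (Z a k)\<^sup>2"
      using cubeD[OF b, of a] that by (auto simp: power_mult_distrib)
    ultimately show ?thesis using square_combination_le[of "U a k" "b a * Z a k" "W a k"] by simp
  qed
  have fibres: "(\<Sum>a<N. (\<Sum>i\<in>\<Omega>. if idx N k i = a then f i else 0)\<^sup>2) = (\<Sum>i\<in>\<Omega>. (f i)\<^sup>2)" for f :: "nat \<Rightarrow> real" and k
    using fin Om N by (intro sum_square_fibres inj_on_idx) (auto simp: idx_less)
  have R2: "(\<Sum>i\<in>\<Omega>. (R i)\<^sup>2) = n * ((\<Sum>k\<in>T. \<Sum>l\<in>T. y k * (gram N \<Omega> b k l * y l)) + Y)"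
  proof -
    have "(\<Sum>i\<in>\<Omega>. (R i)\<^sup>2) = (\<Sum>i\<in>\<Omega>. \<Sum>k\<in>T. \<Sum>l\<in>T. y k * (b (idx N k i) * b (idx N l i) * y l))"
      unfolding R_def power2_eq_square sum_product by (intro sum.cong refl) simp
    also have "\<dots> = (\<Sum>k\<in>T. \<Sum>l\<in>T. \<Sum>i\<in>\<Omega>. y k * (b (idx N k i) * b (idx N l i) * y l))"
      by (subst sum.swap, rule sum.cong[OF refl], rule sum.swap)
    also have "\<dots> = (\<Sum>k\<in>T. \<Sum>l\<in>T. n * (y k * (gram N \<Omega> b k l * y l)) + (if l = k then n * (y k)\<^sup>2 else 0))"
    proof (intro sum.cong refl)
      fix k l
      have "(\<Sum>i\<in>\<Omega>. y k * (b (idx N k i) * b (idx N l i) * y l)) = y k * ((\<Sum>i\<in>\<Omega>. b (idx N k i) * b (idx N l i)) * y l)"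
        by (simp add: sum_distrib_left sum_distrib_right)
      also have "\<dots> = n * (y k * (gram N \<Omega> b k l * y l)) + (if l = k then n * (y k)\<^sup>2 else 0)"
        using n by (auto simp: gram_def n_def bb power2_eq_square)
      finally show "(\<Sum>i\<in>\<Omega>. y k * (b (idx N k i) * b (idx N l i) * y l))
          = n * (y k * (gram N \<Omega> b k l * y l)) + (if l = k then n * (y k)\<^sup>2 else 0)" .
    qed
    also have "\<dots> = n * ((\<Sum>k\<in>T. \<Sum>l\<in>T. y k * (gram N \<Omega> b k l * y l)) + Y)"
      using fin by (simp add: sum.distrib Y_def distrib_left flip: sum_distrib_left)
    finally show ?thesis .
  qed
  have U2: "(\<Sum>a<N. (U a k)\<^sup>2) = (\<Sum>i\<in>\<Omega>. (R i)\<^sup>2)" for k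
    unfolding U_def fibres by (intro sum.cong refl) (simp add: power_mult_distrib power2_eq_square[of "b _"] bb)
  have W2: "(\<Sum>a<N. (W a k)\<^sup>2) = n * (y k)\<^sup>2" for k
    unfolding W_def fibres by (simp add: n_def)
  have Z2: "(\<Sum>a<N. (Z a k)\<^sup>2) \<le> S * Y" if "k \<in> T" for k
    unfolding Z_def S_def Y_def
    using that T by (intro circular_convolution_le[OF N T(1) fin(2)] spectral_peak_ge) auto
  have "n\<^sup>2 * (\<Sum>a<N. \<Sum>k\<in>T. (V a k)\<^sup>2) = (\<Sum>a<N. \<Sum>k\<in>T. (n * V a k)\<^sup>2)"
    by (simp add: sum_distrib_left power_mult_distrib)
  also have "\<dots> \<le> (\<Sum>a<N. \<Sum>k\<in>T. 12 * ((U a k)\<^sup>2 + (Z a k)\<^sup>2 + 4 * (W a k)\<^sup>2))"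
    by (intro sum_mono pt) auto
  also have "\<dots> = (\<Sum>k\<in>T. \<Sum>a<N. 12 * ((U a k)\<^sup>2 + (Z a k)\<^sup>2 + 4 * (W a k)\<^sup>2))"
    by (rule sum.swap)
  also have "\<dots> = (\<Sum>k\<in>T. 12 * ((\<Sum>a<N. (U a k)\<^sup>2) + (\<Sum>a<N. (Z a k)\<^sup>2) + 4 * (\<Sum>a<N. (W a k)\<^sup>2)))"
    by (simp add: sum.distrib flip: sum_distrib_left)
  also have "\<dots> \<le> (\<Sum>k\<in>T. 12 * ((\<Sum>i\<in>\<Omega>. (R i)\<^sup>2) + S * Y + 4 * (n * (y k)\<^sup>2)))"
    unfolding U2 W2 by (intro sum_mono mult_left_mono add_mono Z2 order.refl) auto
  also have "\<dots> = 12 * (d * (\<Sum>i\<in>\<Omega>. (R i)\<^sup>2) + d * (S * Y) + 4 * (n * Y))"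
    by (simp add: sum.distrib d_def Y_def distrib_left flip: sum_distrib_left)
  \<comment> \<open>The diagonal term lacks the factor \<open>d\<close>; \<open>d \<ge> 1\<close>
    puts it on the same footing as the others.\<close>
  also have "\<dots> \<le> 12 * (d * (\<Sum>i\<in>\<Omega>. (R i)\<^sup>2) + d * (S * Y) + d * (4 * (n * Y)))"
  proof -
    have "0 \<le> 4 * (n * Y)" using n by (simp add: Y_def sum_nonneg)
    from mult_right_mono[OF d this] show ?thesis by simp
  qed
  also have "\<dots> = n\<^sup>2 * (12 * d / n * ((\<Sum>k\<in>T. \<Sum>l\<in>T. y k * (gram N \<Omega> b k l * y l)) + (S / n + 5) * Y))"
    unfolding R2 using n by (simp add: power2_eq_square field_simps)
  finally have "(\<Sum>a<N. \<Sum>k\<in>T. (V a k)\<^sup>2) \<le> 12 * d / n * ((\<Sum>k\<in>T. \<Sum>l\<in>T. y k * (gram N \<Omega> b k l * y l)) + (S / n + 5) * Y)"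
    by (rule mult_left_le_imp_le) (use n in simp)
  thus ?thesis by (simp add: V_def n_def d_def S_def Y_def)
qed

text \<open>\<open>gram_variation_le\<close> is applied to each column of the power
  \<open>p - 1\<close>. The quadratic forms add up to the odd trace moment, the squared norms to the
  even one below it.\<close>

lemma gram_moment_recursion:
  assumes T: "T \<subseteq> {..<N}" "T \<noteq> {}" and b: "b \<in> cube {..<N}" and Om: "\<Omega> \<subseteq> {..<N}" "\<Omega> \<noteq> {}" and p: "p > 0"
  defines "G \<equiv> gram N \<Omega>"
  defines "H \<equiv> (\<lambda>a b i j. G b i j - G (flip a b) i j)"
  shows "(\<Sum>a<N. hs T (mmul T (H a b) (mpow T (G b) (p - 1))) (mmul T (H a b) (mpow T (G b) (p - 1))))
    \<le> 12 * real (card T) / real (card \<Omega>) *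
       (mtr T (mpow T (G b) (2 * p - 1)) + (spectral_peak N \<Omega> b / real (card \<Omega>) + 5) * mtr T (mpow T (G b) (2 * (p - 1))))"
proof -
  define X where "X = mpow T (G b) (p - 1)"
  define c where "c = 12 * real (card T) / real (card \<Omega>)"
  define m where "m = spectral_peak N \<Omega> b / real (card \<Omega>) + 5"
  have fin: "finite T" using T finite_subset by auto
  have sym: "msym T (G b)" by (simp add: G_def msym_gram)
  have "(\<Sum>a<N. hs T (mmul T (H a b) X) (mmul T (H a b) X))
      = (\<Sum>a<N. \<Sum>j\<in>T. \<Sum>k\<in>T. (\<Sum>l\<in>T. H a b k l * X l j)\<^sup>2)"
    unfolding hs_def by (rule sum.cong[OF refl], subst sum.swap) (simp add: mmul_def power2_eq_square)
  also have "\<dots> = (\<Sum>j\<in>T. \<Sum>a<N. \<Sum>k\<in>T. (\<Sum>l\<in>T. H a b k l * X l j)\<^sup>2)"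
    by (rule sum.swap)
  also have "\<dots> \<le> (\<Sum>j\<in>T. c * ((\<Sum>k\<in>T. \<Sum>l\<in>T. X k j * (G b k l * X l j)) + m * (\<Sum>k\<in>T. (X k j)\<^sup>2)))"
    unfolding c_def m_def H_def G_def
    by (intro sum_mono gram_variation_le T b Om)
  also have "\<dots> = c * ((\<Sum>j\<in>T. \<Sum>k\<in>T. \<Sum>l\<in>T. X k j * (G b k l * X l j)) + m * (\<Sum>j\<in>T. \<Sum>k\<in>T. (X k j)\<^sup>2))"
    by (simp add: sum.distrib flip: sum_distrib_left)
  also have "(\<Sum>j\<in>T. \<Sum>k\<in>T. \<Sum>l\<in>T. X k j * (G b k l * X l j)) = hs T X (mmul T (G b) X)"
    unfolding hs_def by (subst sum.swap) (simp add: mmul_def sum_distrib_left)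
  also have "\<dots> = mtr T (mpow T (G b) (2 * p - 1))"
  proof -
    have "mmul T (G b) X = mpow T (G b) p" using p by (cases p) (auto simp: X_def)
    moreover have "p - 1 + p = 2 * p - 1" using p by simp
    ultimately show ?thesis using hs_mpow[OF fin sym, of "p - 1" p] by (simp add: X_def)
  qed
  also have "(\<Sum>j\<in>T. \<Sum>k\<in>T. (X k j)\<^sup>2) = hs T X X"
    unfolding hs_def by (subst sum.swap) (simp add: power2_eq_square)
  also have "\<dots> = mtr T (mpow T (G b) (2 * (p - 1)))"
    unfolding X_def hs_mpow[OF fin sym] mult_2 ..
  finally show ?thesis by (simp add: X_def c_def m_def)
qed

text \<open>A self-bounding argument: the recursion bounds the trace moment by half of itself plus a
  multiple of the moments of the spectral peak, and the half is moved to the left.\<close>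

lemma gram_mtr_moment_le:
  assumes T: "T \<subseteq> {..<N}" "T \<noteq> {}" and Om: "\<Omega> \<subseteq> {..<N}" "\<Omega> \<noteq> {}" and p: "p > 0"
    and small: "12 * real p * real (card T) \<le> real (card \<Omega>)"
  shows "(\<Sum>b\<in>cube {..<N}. mtr T (mpow T (gram N \<Omega> b) (2 * p)))
    \<le> 2 ^ N * (5 * real N ^ 3 * (576 * (real p)\<^sup>2 * real (card T) / real (card \<Omega>)) ^ p)"
proof -
  define n where "n = real (card \<Omega>)"
  define d where "d = real (card T)"
  \<comment> \<open>An upper bound for the prefactor \<open>(2 * p - 1) / 4 * (12 * d / n)\<close>;
    \<open>small\<close> makes it at most 1/2.\<close>
  define \<beta> where "\<beta> = 6 * real p * d / n"
  \<comment> \<open>The constant 6 instead of 5 makes room for the half of \<open>q'\<close> that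
    comes from the odd trace moment.\<close>
  define m where "m = (\<lambda>b. spectral_peak N \<Omega> b / n + 6)"
  define q where "q = (\<lambda>b. mtr T (mpow T (gram N \<Omega> b) (2 * p)))"
  define q' where "q' = (\<lambda>b. mtr T (mpow T (gram N \<Omega> b) (2 * (p - 1))))"
  have fin: "finite T" "finite \<Omega>" using T Om finite_subset by auto
  have N: "N > 0" using T by auto
  have n: "n > 0" using Om fin by (simp add: n_def card_gt_0_iff)
  have d: "d > 0" "d \<le> real N" using T fin card_mono[of "{..<N}" T] by (auto simp: d_def card_gt_0_iff)
  have \<beta>: "\<beta> > 0" "\<beta> \<le> 1 / 2" using small n d p by (auto simp: \<beta>_def n_def d_def field_simps)
  have peak: "spectral_peak N \<Omega> b \<ge> 0" for b
    using spectral_peak_ge[OF N N] by (rule order.trans[rotated]) simp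
  have m: "m b > 0" for b using peak[of b] n by (simp add: m_def add_nonneg_pos)
  have pt: "(2 * real p - 1) / 4 * (12 * d / n * (mtr T (mpow T (gram N \<Omega> b) (2 * p - 1)) + (m b - 1) * q' b))
      \<le> q b / 2 + d * (4 * \<beta>) ^ p * m b ^ p / 4" for b
  proof -
    have q0: "q b \<ge> 0" "q' b \<ge> 0" unfolding q_def q'_def by (intro mtr_mpow_even_nonneg fin msym_gram)+
    have odd: "mtr T (mpow T (gram N \<Omega> b) (2 * p - 1)) \<le> (q b + q' b) / 2"
      unfolding q_def q'_def by (intro mtr_mpow_odd_le fin msym_gram p)
    have "mtr T (mpow T (gram N \<Omega> b) (2 * p - 1)) + (m b - 1) * q' b \<le> q b / 2 + m b * q' b"
      using odd q0 by (simp add: left_diff_distrib)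
    moreover have "(2 * real p - 1) / 4 * (12 * d / n) \<le> \<beta>"
      using n d p by (simp add: \<beta>_def field_simps)
    moreover have "0 \<le> (2 * real p - 1) / 4 * (12 * d / n)"
      using n d p by (intro mult_nonneg_nonneg divide_nonneg_nonneg) auto
    moreover have "0 \<le> q b / 2 + m b * q' b" using q0 m[of b] by simp
    ultimately have "(2 * real p - 1) / 4 * (12 * d / n) * (mtr T (mpow T (gram N \<Omega> b) (2 * p - 1)) + (m b - 1) * q' b)
        \<le> \<beta> * (q b / 2 + m b * q' b)"
      by (meson mult_left_mono mult_right_mono order.trans)
    also have "\<dots> \<le> q b / 4 + \<beta> * m b * q' b"
      using mult_right_mono[OF \<beta>(2) q0(1)] by (simp add: distrib_left)
    \<comment> \<open>The weight \<open>4 * \<beta> * m b\<close> is chosen so that exactly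
      \<open>q b / 4\<close> reappears; with the quarter from the odd moment this makes
      \<open>q b / 2\<close>.\<close>
    also have "\<beta> * m b * q' b \<le> \<beta> * m b * ((4 * \<beta> * m b) ^ (p - 1) * d + q b / (4 * \<beta> * m b))"
      using \<beta> m[of b] unfolding q_def q'_def d_def
      by (intro mult_left_mono mtr_mpow_interpolate fin msym_gram p) auto
    also have "\<dots> = d * (4 * \<beta> * m b) ^ p / 4 + q b / 4"
      using p \<beta> m[of b] by (cases p) (simp_all add: field_simps)
    also have "q b / 4 + (d * (4 * \<beta> * m b) ^ p / 4 + q b / 4) = q b / 2 + d * (4 * \<beta>) ^ p * m b ^ p / 4"
      by (simp add: power_mult_distrib)
    finally show ?thesis by (simp only: mult.assoc)
  qed
  have "(\<Sum>b\<in>cube {..<N}. q b) \<le> (2 * real p - 1) / 4 * (\<Sum>b\<in>cube {..<N}. 12 * d / n *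
      (mtr T (mpow T (gram N \<Omega> b) (2 * p - 1)) + (m b - 1) * q' b))"
  proof -
    have "(\<Sum>b\<in>cube {..<N}. q b) \<le> (2 * real p - 1) / 4 *
      (\<Sum>b\<in>cube {..<N}. \<Sum>a<N. hs T (mmul T (\<lambda>i j. gram N \<Omega> b i j - gram N \<Omega> (flip a b) i j) (mpow T (gram N \<Omega> b) (p - 1)))
         (mmul T (\<lambda>i j. gram N \<Omega> b i j - gram N \<Omega> (flip a b) i j) (mpow T (gram N \<Omega> b) (p - 1))))"
      unfolding q_def
      using T by (intro chaos_mtr_moment_le fin p msym_gram gram_homogeneous) auto
    also have "\<dots> \<le> (2 * real p - 1) / 4 * (\<Sum>b\<in>cube {..<N}. 12 * d / n *
      (mtr T (mpow T (gram N \<Omega> b) (2 * p - 1)) + (spectral_peak N \<Omega> b / n + 5) * q' b))"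
      unfolding d_def n_def q'_def using p
      by (intro mult_left_mono sum_mono gram_moment_recursion T Om p) auto
    finally show ?thesis by (simp add: m_def add.commute)
  qed
  also have "\<dots> = (\<Sum>b\<in>cube {..<N}. (2 * real p - 1) / 4 * (12 * d / n *
      (mtr T (mpow T (gram N \<Omega> b) (2 * p - 1)) + (m b - 1) * q' b)))"
    by (rule sum_distrib_left)
  also have "\<dots> \<le> (\<Sum>b\<in>cube {..<N}. q b / 2 + d * (4 * \<beta>) ^ p * m b ^ p / 4)"
    by (intro sum_mono pt)
  also have "\<dots> = (\<Sum>b\<in>cube {..<N}. q b) / 2 + d * (4 * \<beta>) ^ p / 4 * (\<Sum>b\<in>cube {..<N}. m b ^ p)"
    by (simp add: sum.distrib sum_distrib_left sum_divide_distrib)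
  finally have "(\<Sum>b\<in>cube {..<N}. q b) \<le> d * (4 * \<beta>) ^ p / 2 * (\<Sum>b\<in>cube {..<N}. m b ^ p)"
    by simp
  also have "\<dots> \<le> d * (4 * \<beta>) ^ p / 2 * (2 ^ N * (5 * (real N)\<^sup>2 * (24 * real p) ^ p))"
  proof (intro mult_left_mono)
    have "(\<Sum>b\<in>cube {..<N}. m b ^ p) \<le> (\<Sum>b\<in>cube {..<N}. 2 ^ p * (spectral_peak N \<Omega> b ^ p / n ^ p + 6 ^ p))"
      unfolding m_def power_divide[symmetric] using peak n by (intro sum_mono add_power_le) auto
    also have "\<dots> = 2 ^ p * ((\<Sum>b\<in>cube {..<N}. spectral_peak N \<Omega> b ^ p) / n ^ p + 2 ^ N * 6 ^ p)"
      by (simp add: sum.distrib card_cube flip: sum_distrib_left sum_divide_distrib)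
    also have "\<dots> \<le> 2 ^ p * (2 ^ N * (4 * (real N)\<^sup>2 * (12 * real p * n) ^ p) / n ^ p + 2 ^ N * 6 ^ p)"
      using n unfolding n_def
      by (intro mult_left_mono add_mono divide_right_mono spectral_peak_moment_le Om p) auto
    also have "\<dots> = 2 ^ N * (4 * (real N)\<^sup>2 * (24 * real p) ^ p + 12 ^ p)"
    proof -
      have "(12 * real p * n) ^ p / n ^ p = (12 * real p) ^ p" using n by (simp add: power_mult_distrib)
      moreover have "2 ^ p * (12 * real p) ^ p = (24 * real p) ^ p" "2 ^ p * 6 ^ p = (12 :: real) ^ p"
        by (subst power_mult_distrib[symmetric]; simp)+
      moreover have "e * (M * (c * A) / B + M * r) = M * (c * (e * (A / B)) + e * r)" for e M c A B r :: real
        by (simp add: algebra_simps)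
      ultimately show ?thesis by (simp only:)
    qed
    also have "\<dots> \<le> 2 ^ N * (4 * (real N)\<^sup>2 * (24 * real p) ^ p + (real N)\<^sup>2 * (24 * real p) ^ p)"
    proof -
      have "1 * 12 ^ p \<le> (real N)\<^sup>2 * (24 * real p) ^ p"
        using N p by (intro mult_mono power_mono) auto
      hence "12 ^ p \<le> (real N)\<^sup>2 * (24 * real p) ^ p" by (simp only: mult_1)
      thus ?thesis by (intro mult_left_mono add_left_mono) simp_all
    qed
    finally show "(\<Sum>b\<in>cube {..<N}. m b ^ p) \<le> 2 ^ N * (5 * (real N)\<^sup>2 * (24 * real p) ^ p)"
      by (simp add: mult_ac)
  qed (use d \<beta> in auto)
  also have "\<dots> = 2 ^ N * (5 * (real N)\<^sup>2 * (d / 2) * ((4 * \<beta>) ^ p * (24 * real p) ^ p))"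
    by simp
  also have "\<dots> \<le> 2 ^ N * (5 * (real N)\<^sup>2 * real N * ((4 * \<beta>) ^ p * (24 * real p) ^ p))"
    using d \<beta> by (intro mult_left_mono mult_right_mono) auto
  \<comment> \<open>Here 576 is \<open>4 * 6 * 24\<close>: the interpolation weight, the constant in
    \<open>\<beta>\<close> and the peak moment.\<close>
  also have "(4 * \<beta>) ^ p * (24 * real p) ^ p = (576 * (real p)\<^sup>2 * d / n) ^ p"
    unfolding power_mult_distrib[symmetric] by (simp add: \<beta>_def power2_eq_square mult_ac)
  finally show ?thesis by (simp add: q_def d_def n_def power3_eq_cube power2_eq_square mult_ac)
qed

section \<open>Recovery from a certificate\<close>

lemma mvec_le_of_mtr:
  assumes T: "finite T" "T \<noteq> {}" and A: "msym T A" and D: "D > 0" and p: "p > 0"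
    and tr: "mtr T (mpow T A (2 * p)) \<le> D ^ p"
  shows "(\<Sum>k\<in>T. (\<Sum>i\<in>T. A k i * y i)\<^sup>2) \<le> D * (\<Sum>i\<in>T. (y i)\<^sup>2)"
proof -
  \<comment> \<open>All columns equal \<open>y\<close>, so both squared Frobenius norms carry the
    same factor \<open>card T\<close>.\<close>
  define X where "X = (\<lambda>i j::'a. y i)"
  have "hs T (mmul T A X) (mmul T A X) \<le> D * hs T X X"
    using hs_mmul_le_of_mtr[OF T(1) A D p tr] .
  moreover have "hs T (mmul T A X) (mmul T A X) = real (card T) * (\<Sum>k\<in>T. (\<Sum>i\<in>T. A k i * y i)\<^sup>2)"
    by (simp add: hs_def mmul_def X_def power2_eq_square sum_distrib_left)
  moreover have "hs T X X = real (card T) * (\<Sum>i\<in>T. (y i)\<^sup>2)"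
    by (simp add: hs_def X_def power2_eq_square sum_distrib_left)
  ultimately have "real (card T) * (\<Sum>k\<in>T. (\<Sum>i\<in>T. A k i * y i)\<^sup>2) \<le> real (card T) * (D * (\<Sum>i\<in>T. (y i)\<^sup>2))"
    by (simp add: mult_ac)
  thus ?thesis using T by (simp add: card_gt_0_iff)
qed

lemma mcolumn_le_of_mtr:
  assumes T: "finite T" "l \<in> T" and A: "msym T A" and D: "D > 0" and p: "p > 0"
    and tr: "mtr T (mpow T A (2 * p)) \<le> D ^ p"
  shows "(\<Sum>k\<in>T. (A k l)\<^sup>2) \<le> D"
  using mvec_le_of_mtr[OF T(1) _ A D p tr, of "\<lambda>i. if i = l then 1 else 0"] T
  by (auto simp: if_distrib[of "\<lambda>x. _ * x"] if_distrib[of "\<lambda>x. x ^ 2"] cong: if_cong)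

section \<open>Truncated Neumann series\<close>

definition nstep :: "'a set \<Rightarrow> 'a matr \<Rightarrow> ('a \<Rightarrow> real) \<Rightarrow> 'a \<Rightarrow> real" where
  "nstep T A y = (\<lambda>k. - (\<Sum>i\<in>T. A k i * y i))"

text \<open>Truncating the Neumann series of \<open>(1 + A)\<^sup>-\<^sup>1\<close> avoids constructing the inverse; the remainder after
  \<open>card T + 2\<close> terms is at most \<open>1 / 4\<close> in the recovery argument.\<close>

definition neumann :: "'a set \<Rightarrow> 'a matr \<Rightarrow> nat \<Rightarrow> ('a \<Rightarrow> real) \<Rightarrow> 'a \<Rightarrow> real" where
  "neumann T A m g = (\<lambda>k. \<Sum>j<m. (nstep T A ^^ j) g k)"

lemma nstep_adjoint:
  assumes "msym T A"
  shows "(\<Sum>k\<in>T. nstep T A x k * y k) = (\<Sum>k\<in>T. x k * nstep T A y k)"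
proof -
  have "(\<Sum>k\<in>T. \<Sum>i\<in>T. A k i * x i * y k) = (\<Sum>k\<in>T. \<Sum>i\<in>T. x k * (A k i * y i))"
    using assms by (subst sum.swap) (auto simp: msym_def intro!: sum.cong)
  thus ?thesis by (simp add: nstep_def sum_negf sum_distrib_left sum_distrib_right)
qed

lemma nstep_funpow_adjoint:
  assumes "msym T A"
  shows "(\<Sum>k\<in>T. (nstep T A ^^ j) x k * y k) = (\<Sum>k\<in>T. x k * (nstep T A ^^ j) y k)"
proof (induction j arbitrary: y)
  case (Suc j)
  have "(\<Sum>k\<in>T. (nstep T A ^^ Suc j) x k * y k) = (\<Sum>k\<in>T. (nstep T A ^^ j) x k * nstep T A y k)"
    by (simp add: nstep_adjoint[OF assms])
  also have "\<dots> = (\<Sum>k\<in>T. x k * (nstep T A ^^ j) (nstep T A y) k)" by (rule Suc.IH)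
  finally show ?case by (simp add: funpow_swap1)
qed simp

lemma nstep_funpow_L2_le:
  assumes step: "\<And>y. L2_set (nstep T A y) T \<le> \<delta> * L2_set y T" and "\<delta> \<ge> 0"
  shows "L2_set ((nstep T A ^^ j) y) T \<le> \<delta> ^ j * L2_set y T"
proof (induction j)
  case (Suc j)
  have "L2_set ((nstep T A ^^ Suc j) y) T \<le> \<delta> * L2_set ((nstep T A ^^ j) y) T"
    using step by simp
  also have "\<dots> \<le> \<delta> * (\<delta> ^ j * L2_set y T)"
    using Suc assms by (intro mult_left_mono)
  finally show ?case by (simp add: mult.assoc)
qed simp

lemma L2_set_sum_le: "L2_set (\<lambda>k. \<Sum>l\<in>S. f l k) T \<le> (\<Sum>l\<in>S. L2_set (f l) T)"
proof (induction S rule: infinite_finite_induct)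
  case (insert x F)
  have "L2_set (\<lambda>k. f x k + (\<Sum>l\<in>F. f l k)) T \<le> L2_set (f x) T + L2_set (\<lambda>k. \<Sum>l\<in>F. f l k) T"
    by (rule L2_set_triangle_ineq)
  thus ?case using insert by simp
qed (auto simp: L2_set_def)

lemma neumann_L2_le:
  assumes step: "\<And>y. L2_set (nstep T A y) T \<le> \<delta> * L2_set y T" and \<delta>: "\<delta> \<ge> 0" "\<delta> \<le> 1 / 2"
  shows "L2_set (neumann T A m g) T \<le> 2 * L2_set g T"
proof -
  have "L2_set (neumann T A m g) T \<le> (\<Sum>j<m. L2_set ((nstep T A ^^ j) g) T)"
    unfolding neumann_def by (rule L2_set_sum_le)
  also have "\<dots> \<le> (\<Sum>j<m. (1/2) ^ j * L2_set g T)"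
  proof (intro sum_mono)
    fix j
    have "L2_set ((nstep T A ^^ j) g) T \<le> \<delta> ^ j * L2_set g T"
      by (intro nstep_funpow_L2_le step \<delta>)
    also have "\<dots> \<le> (1/2) ^ j * L2_set g T"
      using \<delta> by (intro mult_right_mono power_mono L2_set_nonneg)
    finally show "L2_set ((nstep T A ^^ j) g) T \<le> (1/2) ^ j * L2_set g T" .
  qed
  also have "\<dots> = (\<Sum>j<m. (1/2) ^ j) * L2_set g T" by (simp add: sum_distrib_right)
  also have "\<dots> \<le> 2 * L2_set g T"
    by (intro mult_right_mono L2_set_nonneg) (simp add: geometric_sum)
  finally show ?thesis .
qed

lemma inner_le_L2: "\<bar>\<Sum>k\<in>T. x k * y k\<bar> \<le> L2_set x T * L2_set y T"
proof -
  have "\<bar>\<Sum>k\<in>T. x k * y k\<bar> \<le> (\<Sum>k\<in>T. \<bar>x k\<bar> * \<bar>y k\<bar>)"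
    by (rule order.trans[OF sum_abs]) (simp add: abs_mult)
  thus ?thesis using L2_set_mult_ineq[of x y T] by linarith
qed

text \<open>Multiplying the kernel equations by the transposed matrix gives
  \<open>(1 + G) v = 0\<close>; row \<open>k\<close> is solved for \<open>v k\<close> and the sum is
  split at \<open>T\<close>.\<close>

lemma gram_kernel_eq:
  assumes T: "T \<subseteq> {..<N}" and b: "b \<in> cube {..<N}" and Om: "\<Omega> \<subseteq> {..<N}" "\<Omega> \<noteq> {}" and k: "k \<in> T"
    and ker: "\<And>i. i \<in> \<Omega> \<Longrightarrow> (\<Sum>j<N. b (idx N j i) * v j) = 0"
  shows "v k = - (\<Sum>l\<in>{..<N} - T. v l * gram N \<Omega> b k l) + nstep T (gram N \<Omega> b) v k"
proof -
  define n where "n = real (card \<Omega>)"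
  have fin: "finite \<Omega>" using Om finite_subset by auto
  have n: "n > 0" using Om fin by (simp add: n_def card_gt_0_iff)
  have kN: "k < N" using T k by auto
  have bb: "b (idx N j i) * b (idx N j i) = 1" for j i
    using b kN by (intro cube_square[of _ "{..<N}"]) (auto simp: idx_less)
  have "0 = (\<Sum>i\<in>\<Omega>. b (idx N k i) * (\<Sum>j<N. b (idx N j i) * v j))"
    using ker by simp
  also have "\<dots> = (\<Sum>j<N. (\<Sum>i\<in>\<Omega>. b (idx N k i) * b (idx N j i)) * v j)"
    unfolding sum_distrib_left sum_distrib_right by (subst sum.swap) (simp add: mult.assoc)
  also have "\<dots> = (\<Sum>j<N. n * (gram N \<Omega> b k j * v j) + (if j = k then n * v j else 0))"
    using n by (intro sum.cong refl) (auto simp: gram_def n_def bb)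
  also have "\<dots> = n * ((\<Sum>j<N. gram N \<Omega> b k j * v j) + v k)"
    using kN by (simp add: sum.distrib distrib_left sum_distrib_left)
  finally have "v k = - (\<Sum>j<N. gram N \<Omega> b k j * v j)" using n by auto
  also have "(\<Sum>j<N. gram N \<Omega> b k j * v j) = (\<Sum>j\<in>{..<N} - T. gram N \<Omega> b k j * v j) + (\<Sum>j\<in>T. gram N \<Omega> b k j * v j)"
    using T by (intro sum.subset_diff) auto
  finally show ?thesis by (simp add: nstep_def mult.commute)
qed

text \<open>For \<open>v = z - x\<close>, the norm of \<open>z\<close> exceeds that of
  \<open>x\<close> by at least the mass \<open>V\<close> of \<open>v\<close> off \<open>T\<close>
  minus the modulus of the inner product of \<open>\<sigma>\<close> and \<open>v\<close> on
  \<open>T\<close>. Iterating the kernel equation moves this inner product onto the columns off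
  \<open>T\<close>: the truncated series costs at most \<open>V / 2\<close> and the remainder
  \<open>V / 4\<close>.\<close>

lemma recovery_of_certificate:
  assumes T: "T \<subseteq> {..<N}" and b: "b \<in> cube {..<N}" and Om: "\<Omega> \<subseteq> {..<N}" "\<Omega> \<noteq> {}"
    and \<sigma>: "\<sigma> \<in> cube T" and m: "\<And>j. j \<in> T \<Longrightarrow> m j > 0"
    and step: "\<And>y. L2_set (nstep T (gram N \<Omega> b) y) T \<le> \<delta> * L2_set y T" and \<delta>: "\<delta> \<ge> 0" "\<delta> \<le> 1 / 2"
    and coh: "\<And>l. l \<in> {..<N} - T \<Longrightarrow> L2_set (\<lambda>k. gram N \<Omega> b k l) T \<le> \<delta>"
    and cert: "\<And>l. l \<in> {..<N} - T \<Longrightarrow>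
      \<bar>\<Sum>k\<in>T. neumann T (gram N \<Omega> b) (card T + 2) (\<lambda>k. gram N \<Omega> b k l) k * \<sigma> k\<bar> < 1 / 2"
  shows "l1_recovers N \<Omega> (circ_row N b) (signed_vec T m \<sigma>)"
  unfolding l1_recovers_def
proof (intro allI impI, elim conjE exE)
  fix z j0
  define x where "x = signed_vec T m \<sigma>"
  assume feas: "\<forall>i\<in>\<Omega>. circ_row N b i z = circ_row N b i (signed_vec T m \<sigma>)" and j0: "j0 < N" "z j0 \<noteq> signed_vec T m \<sigma> j0"
  define v where "v = (\<lambda>j. z j - x j)"
  define M where "M = card T + 2"
  define A where "A = gram N \<Omega> b"
  define S where "S = {..<N} - T"
  define V where "V = (\<Sum>l\<in>S. \<bar>v l\<bar>)"
  define r where "r = (\<lambda>k. \<Sum>l\<in>S. - v l * A k l)"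
  have fin: "finite T" "finite S" using T finite_subset by (auto simp: S_def)
  have sym: "msym T A" by (simp add: A_def msym_gram)
  have split: "(\<Sum>j<N. f j) = (\<Sum>j\<in>S. f j) + (\<Sum>j\<in>T. f j)" for f :: "nat \<Rightarrow> real"
    unfolding S_def using T by (intro sum.subset_diff) auto
  have ker: "(\<Sum>j<N. b (idx N j i) * v j) = 0" if "i \<in> \<Omega>" for i
    using feas that by (simp add: circ_row_def idx_def v_def x_def right_diff_distrib sum_subtractf)
  have vk: "v k = r k + nstep T A v k" if "k \<in> T" for k
    using gram_kernel_eq[OF T b Om that ker] by (simp add: r_def A_def S_def sum_negf)
  have r_le: "L2_set r T \<le> \<delta> * V"
  proof -
    have "L2_set r T \<le> (\<Sum>l\<in>S. L2_set (\<lambda>k. - v l * A k l) T)"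
      unfolding r_def by (rule L2_set_sum_le)
    also have "\<dots> = (\<Sum>l\<in>S. \<bar>v l\<bar> * L2_set (\<lambda>k. A k l) T)"
      by (simp add: L2_set_def power_mult_distrib real_sqrt_mult flip: sum_distrib_left)
    also have "\<dots> \<le> (\<Sum>l\<in>S. \<bar>v l\<bar> * \<delta>)"
      using coh by (intro sum_mono mult_left_mono) (auto simp: S_def A_def)
    finally show ?thesis by (simp add: V_def sum_distrib_left mult.commute)
  qed
  have v_le: "L2_set v T \<le> V"
  proof -
    have "L2_set v T = L2_set (\<lambda>k. r k + nstep T A v k) T"
      by (intro L2_set_cong vk refl)
    also have "\<dots> \<le> L2_set r T + L2_set (nstep T A v) T" by (rule L2_set_triangle_ineq)
    also have "\<dots> \<le> \<delta> * V + \<delta> * L2_set v T"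
      unfolding A_def using r_le step by (intro add_mono)
    also have "\<dots> \<le> 1/2 * V + 1/2 * L2_set v T"
      using \<delta> by (intro add_mono mult_right_mono) (auto simp: V_def L2_set_nonneg sum_nonneg)
    finally show ?thesis by simp
  qed
  \<comment> \<open>If \<open>v\<close> vanished off \<open>T\<close> it would vanish altogether,
    against the choice of \<open>j0\<close>; this makes the final inequality strict.\<close>
  have V: "V > 0"
  proof (rule ccontr)
    assume "\<not> V > 0"
    moreover have "V \<ge> 0" by (simp add: V_def sum_nonneg)
    ultimately have V0: "V = 0" by simp
    hence "v l = 0" if "l \<in> S" for l
      using that fin by (simp add: V_def sum_nonneg_eq_0_iff)
    moreover have "L2_set v T = 0" using v_le V0 L2_set_nonneg[of v T] by simp
    hence "v k = 0" if "k \<in> T" for k using that fin by (simp add: L2_set_eq_0_iff)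
    ultimately have "v j0 = 0" using j0 by (auto simp: S_def)
    thus False using j0 by (simp add: v_def x_def)
  qed
  \<comment> \<open>Each round substitutes \<open>v = r - A v\<close> on \<open>T\<close> and moves
    \<open>A\<close> to the other side by symmetry.\<close>
  have expand: "(\<Sum>k\<in>T. \<sigma> k * v k) = (\<Sum>j<n. \<Sum>k\<in>T. (nstep T A ^^ j) \<sigma> k * r k) + (\<Sum>k\<in>T. (nstep T A ^^ n) \<sigma> k * v k)" for n
  proof (induction n)
    case (Suc n)
    have "(\<Sum>k\<in>T. (nstep T A ^^ n) \<sigma> k * v k) = (\<Sum>k\<in>T. (nstep T A ^^ n) \<sigma> k * r k + (nstep T A ^^ n) \<sigma> k * nstep T A v k)"
      by (intro sum.cong refl) (subst vk, auto simp: distrib_left)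
    also have "\<dots> = (\<Sum>k\<in>T. (nstep T A ^^ n) \<sigma> k * r k) + (\<Sum>k\<in>T. (nstep T A ^^ Suc n) \<sigma> k * v k)"
      by (simp add: sum.distrib nstep_adjoint[OF sym])
    finally show ?case using Suc by simp
  qed simp
  have main: "(\<Sum>j<M. \<Sum>k\<in>T. (nstep T A ^^ j) \<sigma> k * r k) = (\<Sum>l\<in>S. - v l * (\<Sum>k\<in>T. neumann T A M (\<lambda>k. A k l) k * \<sigma> k))"
  proof -
    have "(\<Sum>k\<in>T. (nstep T A ^^ j) \<sigma> k * r k) = (\<Sum>l\<in>S. - v l * (\<Sum>k\<in>T. (nstep T A ^^ j) \<sigma> k * A k l))" for j
      unfolding r_def sum_distrib_left by (subst sum.swap) (simp add: mult_ac)
    also have "\<dots> j = (\<Sum>l\<in>S. - v l * (\<Sum>k\<in>T. \<sigma> k * (nstep T A ^^ j) (\<lambda>k. A k l) k))" for j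
      by (simp only: nstep_funpow_adjoint[OF sym])
    finally have "(\<Sum>j<M. \<Sum>k\<in>T. (nstep T A ^^ j) \<sigma> k * r k) = (\<Sum>j<M. \<Sum>l\<in>S. - v l * (\<Sum>k\<in>T. \<sigma> k * (nstep T A ^^ j) (\<lambda>k. A k l) k))"
      by simp
    also have "\<dots> = (\<Sum>l\<in>S. - v l * (\<Sum>j<M. \<Sum>k\<in>T. \<sigma> k * (nstep T A ^^ j) (\<lambda>k. A k l) k))"
      by (subst sum.swap) (simp only: sum_distrib_left)
    also have "\<dots> = (\<Sum>l\<in>S. - v l * (\<Sum>k\<in>T. neumann T A M (\<lambda>k. A k l) k * \<sigma> k))"
    proof -
      have "(\<Sum>j<M. \<Sum>k\<in>T. \<sigma> k * (nstep T A ^^ j) (\<lambda>k. A k l) k) = (\<Sum>k\<in>T. neumann T A M (\<lambda>k. A k l) k * \<sigma> k)" for l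
        unfolding neumann_def sum_distrib_right by (subst sum.swap) (simp add: mult.commute)
      thus ?thesis by (simp only:)
    qed
    finally show ?thesis .
  qed
  have main_le: "\<bar>\<Sum>l\<in>S. - v l * (\<Sum>k\<in>T. neumann T A M (\<lambda>k. A k l) k * \<sigma> k)\<bar> \<le> V * (1 / 2)"
  proof -
    have "\<bar>\<Sum>l\<in>S. - v l * (\<Sum>k\<in>T. neumann T A M (\<lambda>k. A k l) k * \<sigma> k)\<bar>
        \<le> (\<Sum>l\<in>S. \<bar>v l\<bar> * \<bar>\<Sum>k\<in>T. neumann T A M (\<lambda>k. A k l) k * \<sigma> k\<bar>)"
      by (rule order.trans[OF sum_abs]) (simp add: abs_mult)
    also have "\<dots> \<le> (\<Sum>l\<in>S. \<bar>v l\<bar> * (1 / 2))"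
    proof (intro sum_mono mult_left_mono)
      fix l assume "l \<in> S"
      thus "\<bar>\<Sum>k\<in>T. neumann T A M (\<lambda>k. A k l) k * \<sigma> k\<bar> \<le> 1 / 2"
        using cert[of l] unfolding A_def M_def S_def by linarith
    qed simp
    finally show ?thesis by (simp add: V_def sum_divide_distrib)
  qed
  have rest: "\<bar>\<Sum>k\<in>T. (nstep T A ^^ M) \<sigma> k * v k\<bar> \<le> V * (1 / 4)"
  proof -
    have "L2_set \<sigma> T \<le> (\<Sum>k\<in>T. \<bar>\<sigma> k\<bar>)" by (rule L2_set_le_sum_abs)
    also have "\<dots> = (\<Sum>k\<in>T. 1)"
      using cubeD[OF \<sigma>] by (intro sum.cong refl) fastforce
    finally have \<sigma>_le: "L2_set \<sigma> T \<le> real (card T)" by simp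
    have "\<bar>\<Sum>k\<in>T. (nstep T A ^^ M) \<sigma> k * v k\<bar> \<le> L2_set ((nstep T A ^^ M) \<sigma>) T * L2_set v T"
      by (rule inner_le_L2)
    also have "\<dots> \<le> (\<delta> ^ M * L2_set \<sigma> T) * V"
      using step \<delta> v_le by (intro mult_mono nstep_funpow_L2_le) (auto simp: A_def L2_set_nonneg)
    also have "\<dots> \<le> ((1 / 2) ^ M * real (card T)) * V"
      using \<delta> \<sigma>_le V by (intro mult_mono power_mono) (auto simp: L2_set_nonneg)
    \<comment> \<open>The length \<open>card T + 2\<close> enters here: two factors 1/2 give 1/4,
      and the others absorb the crude bound \<open>card T\<close> for the norm of
      \<open>\<sigma>\<close>.\<close>
    also have "\<dots> \<le> (1 / 4) * V"
    proof (intro mult_right_mono)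
      have "real (card T) \<le> 2 ^ card T" by (metis less_imp_le of_nat_less_two_power)
      thus "(1 / 2) ^ M * real (card T) \<le> 1 / 4"
        by (simp add: M_def power_add power_one_over field_simps)
    qed (use V in simp)
    finally show ?thesis by simp
  qed
  have inner: "\<bar>\<Sum>k\<in>T. \<sigma> k * v k\<bar> \<le> 3 / 4 * V"
    using main_le rest unfolding expand[of M] main by linarith
  have "l1norm N z = (\<Sum>j\<in>S. \<bar>z j\<bar>) + (\<Sum>j\<in>T. \<bar>z j\<bar>)"
    by (simp add: l1norm_def split)
  moreover have "(\<Sum>j\<in>S. \<bar>z j\<bar>) = V"
    unfolding V_def by (intro sum.cong refl) (simp add: v_def x_def signed_vec_def S_def)
  \<comment> \<open>On the support \<open>\<sigma>\<close> is the sign of \<open>x\<close>, so this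
    is the subgradient inequality for the absolute value.\<close>
  moreover have "(\<Sum>j\<in>T. \<bar>x j\<bar> + \<sigma> j * v j) \<le> (\<Sum>j\<in>T. \<bar>z j\<bar>)"
  proof (intro sum_mono)
    fix j assume j: "j \<in> T"
    show "\<bar>x j\<bar> + \<sigma> j * v j \<le> \<bar>z j\<bar>"
      using cubeD[OF \<sigma> j] m[OF j] j by (auto simp: v_def x_def signed_vec_def)
  qed
  moreover have "l1norm N x = (\<Sum>j\<in>T. \<bar>x j\<bar>)"
  proof -
    have "(\<Sum>j\<in>S. \<bar>x j\<bar>) = 0" by (intro sum.neutral) (auto simp: x_def signed_vec_def S_def)
    thus ?thesis by (simp add: l1norm_def split)
  qed
  ultimately show "l1norm N (signed_vec T m \<sigma>) < l1norm N z"
    using inner V unfolding x_def by (simp add: sum.distrib)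
qed

section \<open>Probability of recovery\<close>

lemma card_ge_le_moment:
  fixes f :: "'a \<Rightarrow> real"
  assumes "finite S" "\<And>x. x \<in> S \<Longrightarrow> f x \<ge> 0" "c > 0"
  shows "real (card {x\<in>S. f x > c}) \<le> (\<Sum>x\<in>S. f x) / c"
proof -
  have "c * real (card {x\<in>S. f x > c}) = (\<Sum>x\<in>{x\<in>S. f x > c}. c)" by simp
  also have "\<dots> \<le> (\<Sum>x\<in>{x\<in>S. f x > c}. f x)" by (intro sum_mono) auto
  also have "\<dots> \<le> (\<Sum>x\<in>S. f x)" using assms by (intro sum_mono2) auto
  finally show ?thesis using assms by (simp add: field_simps)
qed

text \<open>Markov's inequality for each \<open>l\<close> and a union bound over \<open>N\<close>
  choices. The sets with \<open>l \<in> T\<close> control the Gram matrix on \<open>T\<close>; the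
  others control the correlations of an outside column.\<close>

lemma gram_tail_le:
  assumes T: "T \<subseteq> {..<N}" and Om: "\<Omega> \<subseteq> {..<N}" "\<Omega> \<noteq> {}" and p: "p > 0" and D: "D > 0"
    and small: "12 * real p * real (card T + 1) \<le> real (card \<Omega>)"
  shows "real (card {b \<in> cube {..<N}. \<exists>l<N. mtr (insert l T) (mpow (insert l T) (gram N \<Omega> b) (2 * p)) > D ^ p})
    \<le> 2 ^ N * (5 * real N ^ 4 * (576 * (real p)\<^sup>2 * real (card T + 1) / real (card \<Omega>) / D) ^ p)"
proof -
  define f where "f = (\<lambda>l b. mtr (insert l T) (mpow (insert l T) (gram N \<Omega> b) (2 * p)))"
  define Q where "Q = 576 * (real p)\<^sup>2 * real (card T + 1) / real (card \<Omega>)"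
  have fin: "finite T" using T finite_subset by auto
  have one: "real (card {b \<in> cube {..<N}. f l b > D ^ p}) \<le> 2 ^ N * (5 * real N ^ 3 * (Q / D) ^ p)" if "l < N" for l
  proof -
    have card: "real (card (insert l T)) \<le> real (card T + 1)"
      using fin by (simp add: card_insert_if)
    have "real (card {b \<in> cube {..<N}. f l b > D ^ p}) \<le> (\<Sum>b\<in>cube {..<N}. f l b) / D ^ p"
      unfolding f_def using fin D by (intro card_ge_le_moment mtr_mpow_even_nonneg msym_gram) auto
    also have "\<dots> \<le> 2 ^ N * (5 * real N ^ 3 * (576 * (real p)\<^sup>2 * real (card (insert l T)) / real (card \<Omega>)) ^ p) / D ^ p"
    proof (intro divide_right_mono)
      have "12 * real p * real (card (insert l T)) \<le> 12 * real p * real (card T + 1)"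
        using card by (intro mult_left_mono) auto
      hence "12 * real p * real (card (insert l T)) \<le> real (card \<Omega>)" using small by linarith
      thus "(\<Sum>b\<in>cube {..<N}. f l b) \<le> 2 ^ N * (5 * real N ^ 3 * (576 * (real p)\<^sup>2 * real (card (insert l T)) / real (card \<Omega>)) ^ p)"
        unfolding f_def using T that Om p by (intro gram_mtr_moment_le) auto
    qed (use D in simp)
    also have "\<dots> \<le> 2 ^ N * (5 * real N ^ 3 * Q ^ p) / D ^ p"
      unfolding Q_def using D card
      by (intro divide_right_mono mult_left_mono power_mono) auto
    finally show ?thesis by (simp add: power_divide)
  qed
  have "{b \<in> cube {..<N}. \<exists>l<N. f l b > D ^ p} = (\<Union>l<N. {b \<in> cube {..<N}. f l b > D ^ p})" by auto
  hence "real (card {b \<in> cube {..<N}. \<exists>l<N. f l b > D ^ p}) \<le> real (\<Sum>l<N. card {b \<in> cube {..<N}. f l b > D ^ p})"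
    by (simp only: of_nat_le_iff) (rule card_UN_le, simp)
  also have "\<dots> \<le> (\<Sum>l<N. 2 ^ N * (5 * real N ^ 3 * (Q / D) ^ p))"
    unfolding of_nat_sum by (intro sum_mono one) auto
  also have "\<dots> = 2 ^ N * (5 * real N ^ 4 * (Q / D) ^ p)"
    by (simp add: power_Suc2[symmetric] eval_nat_numeral)
  finally show ?thesis by (simp only: f_def Q_def)
qed

text \<open>For fixed \<open>b\<close> the trace bounds give operator norm and column norms at most
  \<open>sqrt D\<close>, so every Neumann vector has squared norm at most \<open>4 * D\<close>.
  Hoeffding in the signs and a union bound over columns give the exponent
  \<open>1 / (8 * (4 * D))\<close>.\<close>

lemma recovery_failure_count:
  assumes T: "T \<subseteq> {..<N}" "T \<noteq> {}" and b: "b \<in> cube {..<N}" and Om: "\<Omega> \<subseteq> {..<N}" "\<Omega> \<noteq> {}"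
    and m: "\<And>j. j \<in> T \<Longrightarrow> m j > 0" and D: "D > 0" "D \<le> 1 / 4" and p: "p > 0"
    and good: "\<And>l. l < N \<Longrightarrow> mtr (insert l T) (mpow (insert l T) (gram N \<Omega> b) (2 * p)) \<le> D ^ p"
  shows "real (card {\<sigma> \<in> cube T. \<not> l1_recovers N \<Omega> (circ_row N b) (signed_vec T m \<sigma>)})
    \<le> 2 ^ card T * (2 * real N * exp (- 1 / (32 * D)))"
proof -
  define G where "G = gram N \<Omega> b"
  define \<delta> where "\<delta> = sqrt D"
  define q where "q = (\<lambda>l. neumann T G (card T + 2) (\<lambda>k. G k l))"
  define B where "B = (\<lambda>l. {\<sigma> \<in> cube T. 1 / 2 \<le> \<bar>\<Sum>k\<in>T. q l k * \<sigma> k\<bar>})"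
  have fin: "finite T" using T finite_subset by auto
  have \<delta>: "\<delta> \<ge> 0" "\<delta> \<le> 1 / 2" "\<delta>\<^sup>2 = D"
    using D real_sqrt_le_mono[OF D(2)] by (auto simp: \<delta>_def real_sqrt_divide)
  have step: "L2_set (nstep T G y) T \<le> \<delta> * L2_set y T" for y
  proof -
    obtain l where l: "l \<in> T" using T by auto
    hence "mtr T (mpow T G (2 * p)) \<le> D ^ p"
      using good[of l] T by (auto simp: insert_absorb G_def)
    hence "(\<Sum>k\<in>T. (\<Sum>i\<in>T. G k i * y i)\<^sup>2) \<le> D * (\<Sum>i\<in>T. (y i)\<^sup>2)"
      using fin T D p by (intro mvec_le_of_mtr) (auto simp: G_def msym_gram)
    from real_sqrt_le_mono[OF this] show ?thesis
      by (simp add: L2_set_def nstep_def real_sqrt_mult \<delta>_def)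
  qed
  have coh: "L2_set (\<lambda>k. G k l) T \<le> \<delta>" if "l < N" for l
  proof -
    have "(\<Sum>k\<in>T. (G k l)\<^sup>2) \<le> (\<Sum>k\<in>insert l T. (G k l)\<^sup>2)"
      using fin by (intro sum_mono2) auto
    also have "\<dots> \<le> D"
      using fin D p good[OF that] by (intro mcolumn_le_of_mtr) (auto simp: G_def msym_gram)
    finally show ?thesis by (simp add: L2_set_def \<delta>_def)
  qed
  have q_le: "(\<Sum>k\<in>T. (q l k)\<^sup>2) \<le> 4 * D" if "l < N" for l
  proof -
    have "L2_set (q l) T \<le> 2 * L2_set (\<lambda>k. G k l) T"
      unfolding q_def by (intro neumann_L2_le[OF step] \<delta>)
    also have "\<dots> \<le> 2 * \<delta>" using coh[OF that] by simp
    finally have "(L2_set (q l) T)\<^sup>2 \<le> (2 * \<delta>)\<^sup>2" by (intro power_mono) (auto simp: L2_set_nonneg)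
    thus ?thesis using \<delta>(3) by (simp add: L2_set_def sum_nonneg power_mult_distrib)
  qed
  have "{\<sigma> \<in> cube T. \<not> l1_recovers N \<Omega> (circ_row N b) (signed_vec T m \<sigma>)} \<subseteq> (\<Union>l<N. B l)"
  proof (intro subsetI, rule ccontr)
    fix \<sigma> assume \<sigma>: "\<sigma> \<in> {\<sigma> \<in> cube T. \<not> l1_recovers N \<Omega> (circ_row N b) (signed_vec T m \<sigma>)}" "\<sigma> \<notin> (\<Union>l<N. B l)"
    have "l1_recovers N \<Omega> (circ_row N b) (signed_vec T m \<sigma>)"
    proof (rule recovery_of_certificate[OF T(1) b Om _ m])
      show "\<bar>\<Sum>k\<in>T. neumann T (gram N \<Omega> b) (card T + 2) (\<lambda>k. gram N \<Omega> b k l) k * \<sigma> k\<bar> < 1 / 2"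
        if "l \<in> {..<N} - T" for l
        using \<sigma> that by (auto simp: B_def q_def G_def not_le)
    qed (use \<sigma> \<delta> step coh in \<open>auto simp: G_def\<close>)
    thus False using \<sigma> by simp
  qed
  hence "card {\<sigma> \<in> cube T. \<not> l1_recovers N \<Omega> (circ_row N b) (signed_vec T m \<sigma>)} \<le> card (\<Union>l<N. B l)"
    using fin by (intro card_mono finite_UN_I) (auto simp: B_def)
  also have "\<dots> \<le> (\<Sum>l<N. card (B l))" by (rule card_UN_le) simp
  finally have "real (card {\<sigma> \<in> cube T. \<not> l1_recovers N \<Omega> (circ_row N b) (signed_vec T m \<sigma>)}) \<le> (\<Sum>l<N. real (card (B l)))"
    by (simp only: of_nat_le_iff flip: of_nat_sum)
  also have "\<dots> \<le> (\<Sum>l<N. 2 * 2 ^ card T * exp (- 1 / (8 * (4 * D))))"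
    unfolding B_def using fin D q_le by (intro sum_mono cube_hoeffding) auto
  also have "\<dots> = 2 ^ card T * (2 * real N * exp (- 1 / (32 * D)))" by simp
  finally show ?thesis .
qed

text \<open>Zero is the unique vector of minimal norm, whatever the measurements. This covers empty
  \<open>T\<close>, where \<open>s\<close> may be 0 and \<open>\<Omega>\<close> may be
  empty.\<close>

lemma l1_recovers_zero: "l1_recovers N \<Omega> rw (signed_vec {} m \<sigma>)"
  unfolding l1_recovers_def
proof (intro allI impI, elim conjE exE)
  fix z j assume j: "j < N" "z j \<noteq> signed_vec {} m \<sigma> j"
  have "0 < \<bar>z j\<bar>" using j by (simp add: signed_vec_def)
  also have "\<dots> \<le> l1norm N z" unfolding l1norm_def using j by (intro member_le_sum) auto
  finally show "l1norm N (signed_vec {} m \<sigma>) < l1norm N z"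
    by (simp add: l1norm_def signed_vec_def)
qed

lemma prob_pmf_of_set_ge:
  assumes "finite S" "S \<noteq> {}" "real (card {x \<in> S. x \<notin> E}) \<le> e * real (card S)"
  shows "measure_pmf.prob (pmf_of_set S) E \<ge> 1 - e"
proof -
  have "card S = card (S \<inter> E) + card {x \<in> S. x \<notin> E}"
    using assms(1) by (subst card_Un_disjoint[symmetric]) (auto intro!: arg_cong[of _ _ card])
  moreover have "card S > 0" using assms by (simp add: card_gt_0_iff)
  ultimately have "(1 - e) * real (card S) \<le> real (card (S \<inter> E))" "real (card S) > 0"
    using assms(3) by (auto simp: left_diff_distrib)
  thus ?thesis using assms(1,2)
    by (simp add: measure_pmf_of_set pos_le_divide_eq)
qed

lemma circulant_recovery:
  fixes N s :: nat and \<epsilon> :: real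
  assumes N: "N \<ge> 2" and \<epsilon>: "0 < \<epsilon>" "\<epsilon> < 1" and Om: "\<Omega> \<subseteq> {..<N}"
    and T: "T \<subseteq> {..<N}" "card T \<le> s" and m: "\<And>j. j \<in> T \<Longrightarrow> m j > 0"
    and n: "real (card \<Omega>) \<ge> 10 ^ 8 * real s * (ln (real N / \<epsilon>)) ^ 3"
  shows "measure_pmf.prob (pmf_of_set (cube {..<N} \<times> cube T))
     {(b, \<sigma>). l1_recovers N \<Omega> (circ_row N b) (signed_vec T m \<sigma>)} \<ge> 1 - \<epsilon>"
proof (cases "T = {}")
  case True
  have "{(b, \<sigma>). l1_recovers N \<Omega> (circ_row N b) (signed_vec T m \<sigma>)} = UNIV"
    using True by (auto simp: l1_recovers_zero)
  thus ?thesis using \<epsilon> by simp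
next
  case False
  define L where "L = ln (real N / \<epsilon>)"
  \<comment> \<open>Large enough that \<open>exp (- p) \<le> (\<epsilon> / N) ^ 10\<close>, which
    beats the factor \<open>N ^ 4\<close> of \<open>gram_tail_le\<close>.\<close>
  define p where "p = nat \<lceil>10 * L\<rceil>"
  \<comment> \<open>Makes the Hoeffding exponent \<open>1 / (32 * D)\<close> equal to
    \<open>4 * L\<close>.\<close>
  define D where "D = 1 / (128 * L)"
  define bad where "bad = {b \<in> cube {..<N}. \<exists>l<N. mtr (insert l T) (mpow (insert l T) (gram N \<Omega> b) (2 * p)) > D ^ p}"
  define fail where "fail = (\<lambda>b. {\<sigma> \<in> cube T. \<not> l1_recovers N \<Omega> (circ_row N b) (signed_vec T m \<sigma>)})"
  have fin: "finite T" using T finite_subset by auto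
  have cT: "card T > 0" using False fin by (simp add: card_gt_0_iff)
  hence s: "s \<ge> 1" "real (card T + 1) \<le> 2 * real s" using T by auto
  have N\<epsilon>: "real N / \<epsilon> \<ge> 2" using N \<epsilon> by (simp add: field_simps)
  have L: "L > 1 / 2"
  proof -
    have "1 / 2 < ln (2 :: real)" using ln2_ge_two_thirds by simp
    also have "\<dots> \<le> L" unfolding L_def using N\<epsilon> by simp
    finally show ?thesis .
  qed
  have p: "10 * L \<le> real p" "real p \<le> 12 * L" "p > 0"
    using L by (auto simp: p_def) linarith+
  have n': "real (card \<Omega>) \<ge> 10 ^ 8 * real s * L ^ 3" using n by (simp add: L_def)
  have n0: "10 ^ 8 * real s * L ^ 3 > 0" using s L by simp
  hence "\<Omega> \<noteq> {}" using n' by auto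
  have expL: "exp (- L) = \<epsilon> / real N"
    using N \<epsilon> by (simp add: L_def exp_minus)
  have D: "D > 0" "D \<le> 1 / 4" using L by (auto simp: D_def field_simps)
  have small: "12 * real p * real (card T + 1) \<le> real (card \<Omega>)"
  proof -
    have "12 * real p * real (card T + 1) \<le> 12 * (12 * L) * (2 * real s)"
      using p s L by (intro mult_mono) auto
    also have "\<dots> = 288 * real s * (L * 1)" by simp
    also have "\<dots> \<le> 288 * real s * (L * (4 * L\<^sup>2))"
    proof -
      have "(1 / 2)\<^sup>2 \<le> L\<^sup>2" using L by (intro power_mono) auto
      thus ?thesis using L by (intro mult_left_mono) (auto simp: power2_eq_square)
    qed
    also have "\<dots> = 1152 * real s * L ^ 3" by (simp add: power2_eq_square power3_eq_cube)
    also have "\<dots> \<le> 10 ^ 8 * real s * L ^ 3" using L by (intro mult_right_mono) auto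
    finally show ?thesis using n' by linarith
  qed
  \<comment> \<open>Source of the third power of the logarithm: \<open>p\<^sup>2\<close> contributes
    \<open>L\<^sup>2\<close> and \<open>1 / D\<close> another \<open>L\<close>. The number 21233664
    is \<open>576 * 144 * 2 * 128\<close>.\<close>
  have base: "576 * (real p)\<^sup>2 * real (card T + 1) / real (card \<Omega>) / D \<le> exp (- 1)"
  proof -
    have "576 * (real p)\<^sup>2 * real (card T + 1) / real (card \<Omega>) / D
        \<le> 576 * (12 * L)\<^sup>2 * (2 * real s) / (10 ^ 8 * real s * L ^ 3) / D"
      using p s L n' n0 D by (intro divide_right_mono frac_le mult_mono power_mono) auto
    also have "\<dots> = 21233664 / 10 ^ 8"
      using L s by (simp add: D_def power2_eq_square power3_eq_cube field_simps)
    also have "\<dots> \<le> 1 / 3" by simp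
    also have "\<dots> \<le> exp (- 1)" using exp_le by (simp add: exp_minus field_simps)
    finally show ?thesis .
  qed
  have bad_le: "real (card bad) \<le> 2 ^ N * (\<epsilon> / 2)"
  proof -
    have "real (card bad) \<le> 2 ^ N * (5 * real N ^ 4 * (576 * (real p)\<^sup>2 * real (card T + 1) / real (card \<Omega>) / D) ^ p)"
      unfolding bad_def using T Om \<open>\<Omega> \<noteq> {}\<close> p D small by (intro gram_tail_le) auto
    also have "\<dots> \<le> 2 ^ N * (5 * real N ^ 4 * exp (- 1) ^ p)"
      using base D by (intro mult_left_mono power_mono) auto
    also have "exp (- 1) ^ p \<le> exp (- L) ^ 10"
      using p by (simp flip: exp_of_nat_mult)
    also have "5 * real N ^ 4 * exp (- L) ^ 10 \<le> \<epsilon> / 2"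
    proof -
      have "5 * real N ^ 4 * exp (- L) ^ 10 = 5 * \<epsilon> ^ 10 / real N ^ 6"
        using N by (simp add: expL power_divide field_simps flip: power_add)
      also have "\<dots> \<le> 5 * \<epsilon> ^ 1 / 2 ^ 6"
        using N \<epsilon> by (intro frac_le mult_left_mono power_mono power_decreasing) auto
      also have "\<dots> \<le> \<epsilon> / 2" using \<epsilon> by simp
      finally show ?thesis .
    qed
    finally show ?thesis by (simp add: mult_left_mono)
  qed
  have fail_le: "real (card (fail b)) \<le> 2 ^ card T * (\<epsilon> / 2)" if "b \<in> cube {..<N} - bad" for b
  proof -
    have good: "mtr (insert l T) (mpow (insert l T) (gram N \<Omega> b) (2 * p)) \<le> D ^ p" if "l < N" for l
    proof -
      have "\<not> (\<exists>l<N. mtr (insert l T) (mpow (insert l T) (gram N \<Omega> b) (2 * p)) > D ^ p)"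
        using \<open>b \<in> cube {..<N} - bad\<close> unfolding bad_def by blast
      thus ?thesis using that not_le by blast
    qed
    have "real (card (fail b)) \<le> 2 ^ card T * (2 * real N * exp (- 1 / (32 * D)))"
      unfolding fail_def using that
      by (intro recovery_failure_count[OF T(1) False _ Om \<open>\<Omega> \<noteq> {}\<close> m D p(3) good]) auto
    also have "exp (- 1 / (32 * D)) = exp (- L) ^ 4"
      using L by (simp add: D_def flip: exp_of_nat_mult)
    also have "2 * real N * exp (- L) ^ 4 \<le> \<epsilon> / 2"
    proof -
      have "2 * real N * exp (- L) ^ 4 = 2 * \<epsilon> ^ 4 / real N ^ 3"
        using N by (simp add: expL power_divide field_simps eval_nat_numeral)
      also have "\<dots> \<le> 2 * \<epsilon> ^ 1 / 2 ^ 3"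
        using N \<epsilon> by (intro frac_le mult_left_mono power_mono power_decreasing) auto
      also have "\<dots> \<le> \<epsilon> / 2" using \<epsilon> by simp
      finally show ?thesis .
    qed
    finally show ?thesis by (simp add: mult_left_mono)
  qed
  have finN: "finite (cube {..<N})" by simp
  \<comment> \<open>Every failure comes from a bad \<open>b\<close>, or from bad signs for a good
    \<open>b\<close>; each share is at most \<open>\<epsilon> / 2\<close>.\<close>
  have "{x \<in> cube {..<N} \<times> cube T. x \<notin> {(b, \<sigma>). l1_recovers N \<Omega> (circ_row N b) (signed_vec T m \<sigma>)}}
      \<subseteq> (bad \<times> cube T) \<union> (SIGMA b:cube {..<N} - bad. fail b)"
    by (auto simp: fail_def)
  hence "card {x \<in> cube {..<N} \<times> cube T. x \<notin> {(b, \<sigma>). l1_recovers N \<Omega> (circ_row N b) (signed_vec T m \<sigma>)}}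
      \<le> card ((bad \<times> cube T) \<union> (SIGMA b:cube {..<N} - bad. fail b))"
    using fin by (intro card_mono finite_UnI finite_SigmaI finite_cartesian_product) (auto simp: bad_def fail_def)
  also have "\<dots> \<le> card (bad \<times> cube T) + card (SIGMA b:cube {..<N} - bad. fail b)"
    by (rule card_Un_le)
  also have "\<dots> = card bad * 2 ^ card T + (\<Sum>b\<in>cube {..<N} - bad. card (fail b))"
    using fin by (simp add: card_cartesian_product card_cube fail_def)
  finally have "real (card {x \<in> cube {..<N} \<times> cube T. x \<notin> {(b, \<sigma>). l1_recovers N \<Omega> (circ_row N b) (signed_vec T m \<sigma>)}})
      \<le> real (card bad * 2 ^ card T + (\<Sum>b\<in>cube {..<N} - bad. card (fail b)))"
    by (simp only: of_nat_le_iff)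
  also have "\<dots> = real (card bad) * 2 ^ card T + (\<Sum>b\<in>cube {..<N} - bad. real (card (fail b)))"
    by simp
  also have "\<dots> \<le> 2 ^ N * (\<epsilon> / 2) * 2 ^ card T + (\<Sum>b\<in>cube {..<N} - bad. 2 ^ card T * (\<epsilon> / 2))"
    by (intro add_mono mult_right_mono bad_le sum_mono fail_le) auto
  also have "\<dots> \<le> 2 ^ N * (\<epsilon> / 2) * 2 ^ card T + (\<Sum>b\<in>cube {..<N}. 2 ^ card T * (\<epsilon> / 2))"
    using \<epsilon> by (intro add_left_mono sum_mono2) auto
  also have "\<dots> = \<epsilon> * real (card (cube {..<N} \<times> cube T))"
    using fin by (simp add: card_cartesian_product card_cube)
  finally show ?thesis
    using fin cube_nonempty[of "{..<N}"] cube_nonempty[of T] by (intro prob_pmf_of_set_ge) auto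
qed

section \<open>Toeplitz matrices as submatrices of circulant matrices\<close>

definition toep_embed :: "nat \<Rightarrow> (int \<Rightarrow> real) \<Rightarrow> nat \<Rightarrow> real" where
  "toep_embed N c = (\<lambda>a\<in>{..<2*N-1}. c (if a < N then int a else int a - (2 * int N - 1)))"

text \<open>A negative shift wraps around modulo \<open>2 * N - 1\<close> to an index at least
  \<open>N\<close>, exactly where \<open>toep_embed\<close> stores it.\<close>

lemma toep_embed_idx:
  assumes "i < N" "j < N"
  shows "toep_embed N c (idx (2 * N - 1) j i) = c (int j - int i)"
proof -
  have M: "int (2 * N - 1) = 2 * int N - 1" using assms by simp
  show ?thesis
  proof (cases "i \<le> j")
    case True
    hence "int (idx (2 * N - 1) j i) = int j - int i"
      using assms M by (subst int_idx) (auto intro!: mod_pos_pos_trivial)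
    thus ?thesis using assms True by (auto simp: toep_embed_def)
  next
    case False
    have "(int j - int i) mod int (2 * N - 1) = (int j - int i + int (2 * N - 1)) mod int (2 * N - 1)" by simp
    also have "\<dots> = int j - int i + int (2 * N - 1)"
      using assms False M by (intro mod_pos_pos_trivial) auto
    finally have *: "int (idx (2 * N - 1) j i) = int j - int i + (2 * int N - 1)"
      using assms M by (subst int_idx) auto
    thus ?thesis using assms False by (auto simp: toep_embed_def)
  qed
qed

text \<open>Both sign vectors have length \<open>2 * N - 1\<close>, so the uniform distribution is
  carried over exactly. The restriction in \<open>toep_embed\<close> makes its values extensional,
  as membership in the cube requires.\<close>

lemma bij_betw_toep_embed:
  assumes "N > 0"
  shows "bij_betw (toep_embed N) (cube {-(int N - 1)..int N - 1}) (cube {..<2*N-1})"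
proof (rule bij_betwI[where g = "\<lambda>b. \<lambda>z\<in>{-(int N - 1)..int N - 1}. b (nat (if z \<ge> 0 then z else z + (2 * int N - 1)))"])
  show "toep_embed N \<in> cube {-(int N - 1)..int N - 1} \<rightarrow> cube {..<2*N-1}"
    using assms by (auto simp: toep_embed_def PiE_def Pi_def)
  show "(\<lambda>b. \<lambda>z\<in>{-(int N - 1)..int N - 1}. b (nat (if z \<ge> 0 then z else z + (2 * int N - 1)))) \<in> cube {..<2*N-1} \<rightarrow> cube {-(int N - 1)..int N - 1}"
    using assms by (auto simp: PiE_def Pi_def)
qed (use assms in \<open>auto simp: toep_embed_def fun_eq_iff PiE_def extensional_def nat_less_iff\<close>)

text \<open>On vectors padded with zeros the circulant rows in \<open>\<Omega>\<close> and the
  longer norm agree with their Toeplitz counterparts.\<close>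

lemma l1_recovers_toeplitz:
  assumes Om: "\<Omega> \<subseteq> {..<N}" and T: "T \<subseteq> {..<N}"
    and circ: "l1_recovers (2 * N - 1) \<Omega> (circ_row (2 * N - 1) (toep_embed N c)) (signed_vec T m \<sigma>)"
  shows "l1_recovers N \<Omega> (toep_row N c) (signed_vec T m \<sigma>)"
  unfolding l1_recovers_def
proof (intro allI impI, elim conjE exE)
  fix z :: "nat \<Rightarrow> real" and j
  define x where "x = signed_vec T m \<sigma>"
  \<comment> \<open>A competitor may be nonzero beyond \<open>N\<close>, where the Toeplitz rows
    ignore it but the circulant rows would not.\<close>
  define z' where "z' = (\<lambda>j. if j < N then z j else 0)"
  assume feas: "\<forall>i\<in>\<Omega>. toep_row N c i z = toep_row N c i (signed_vec T m \<sigma>)" and j: "j < N" "z j \<noteq> signed_vec T m \<sigma> j"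
  have x0: "x j = 0" if "\<not> j < N" for j using that T by (auto simp: x_def signed_vec_def)
  have sub: "{..<N} \<subseteq> {..<2*N-1}" using j by auto
  have row: "circ_row (2 * N - 1) (toep_embed N c) i y = toep_row N c i y"
    if "i \<in> \<Omega>" "\<And>j. \<not> j < N \<Longrightarrow> y j = 0" for i y
    unfolding circ_row_def toep_row_def idx_def[symmetric]
    using that Om by (intro sum.mono_neutral_cong_right sub) (auto simp: toep_embed_idx[unfolded One_nat_def])
  have norm: "l1norm (2 * N - 1) y = l1norm N y" if "\<And>j. \<not> j < N \<Longrightarrow> y j = 0" for y
    unfolding l1norm_def using that by (intro sum.mono_neutral_right sub) auto
  have zz: "toep_row N c i z' = toep_row N c i z" "l1norm N z' = l1norm N z" for i
    by (auto simp: toep_row_def l1norm_def z'_def)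
  have "\<forall>i\<in>\<Omega>. circ_row (2 * N - 1) (toep_embed N c) i z' = circ_row (2 * N - 1) (toep_embed N c) i x"
  proof
    fix i assume i: "i \<in> \<Omega>"
    have "circ_row (2 * N - 1) (toep_embed N c) i z' = toep_row N c i z'"
      by (rule row[OF i]) (simp add: z'_def)
    also have "\<dots> = toep_row N c i x" using feas i by (simp add: zz x_def)
    also have "\<dots> = circ_row (2 * N - 1) (toep_embed N c) i x"
      using row[OF i x0] by simp
    finally show "circ_row (2 * N - 1) (toep_embed N c) i z' = circ_row (2 * N - 1) (toep_embed N c) i x" .
  qed
  moreover have "j < 2 * N - 1 \<and> z' j \<noteq> x j" using j by (auto simp: z'_def x_def)
  ultimately have "l1norm (2 * N - 1) x < l1norm (2 * N - 1) z'"
    using circ unfolding l1_recovers_def x_def by blast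
  thus "l1norm N (signed_vec T m \<sigma>) < l1norm N z"
    using norm[of x] norm[of z'] zz x0 by (simp add: x_def z'_def)
qed

text \<open>\<open>M \<le> N^2\<close> at most doubles the logarithm; its third power costs a factor
  8, covered by passing from \<open>10 ^ 8\<close> to \<open>10 ^ 9\<close>.\<close>

lemma toeplitz_recovery:
  fixes N s :: nat and \<epsilon> :: real
  assumes N: "N \<ge> 2" and \<epsilon>: "0 < \<epsilon>" "\<epsilon> < 1" and Om: "\<Omega> \<subseteq> {..<N}"
    and T: "T \<subseteq> {..<N}" "card T \<le> s" and m: "\<And>j. j \<in> T \<Longrightarrow> m j > 0"
    and n: "real (card \<Omega>) \<ge> 10 ^ 9 * real s * (ln (real N / \<epsilon>)) ^ 3"
  shows "measure_pmf.prob (pmf_of_set (cube {-(int N - 1)..int N - 1} \<times> cube T))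
     {(c, \<sigma>). l1_recovers N \<Omega> (toep_row N c) (signed_vec T m \<sigma>)} \<ge> 1 - \<epsilon>"
proof -
  define M where "M = 2 * N - 1"
  define E where "E = {(b, \<sigma>). l1_recovers M \<Omega> (circ_row M b) (signed_vec T m \<sigma>)}"
  have fin: "finite T" using T finite_subset by auto
  have ln_le: "0 \<le> ln (real M / \<epsilon>)" "ln (real M / \<epsilon>) \<le> 2 * ln (real N / \<epsilon>)"
  proof -
    show "0 \<le> ln (real M / \<epsilon>)" using N \<epsilon> by (intro ln_ge_zero) (simp add: M_def field_simps)
    have "2 * real N \<le> real N * real N" using N by (intro mult_right_mono) auto
    moreover have "real M = 2 * real N - 1" using N by (simp add: M_def of_nat_diff)
    ultimately have "real M \<le> real N * real N" by linarith
    hence "real M * \<epsilon> \<le> real N * real N * 1" using \<epsilon> by (intro mult_mono) auto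
    hence "real M / \<epsilon> \<le> (real N / \<epsilon>) * (real N / \<epsilon>)" using \<epsilon> by (simp add: field_simps)
    hence "ln (real M / \<epsilon>) \<le> ln ((real N / \<epsilon>) * (real N / \<epsilon>))"
      using N \<epsilon> by (intro ln_mono) (auto simp: M_def)
    also have "\<dots> = 2 * ln (real N / \<epsilon>)" using N \<epsilon> by (subst ln_mult) auto
    finally show "ln (real M / \<epsilon>) \<le> 2 * ln (real N / \<epsilon>)" .
  qed
  have "10 ^ 8 * real s * ln (real M / \<epsilon>) ^ 3 \<le> 10 ^ 8 * real s * (2 * ln (real N / \<epsilon>)) ^ 3"
    using ln_le by (intro mult_left_mono power_mono) auto
  also have "\<dots> \<le> 10 ^ 9 * real s * ln (real N / \<epsilon>) ^ 3"
    using ln_le by (simp add: power_mult_distrib mult_right_mono)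
  finally have "measure_pmf.prob (pmf_of_set (cube {..<M} \<times> cube T)) E \<ge> 1 - \<epsilon>"
    unfolding E_def using N Om T n by (intro circulant_recovery[OF _ \<epsilon>] m) (auto simp: M_def)
  also have "pmf_of_set (cube {..<M} \<times> cube T) =
      map_pmf (map_prod (toep_embed N) id) (pmf_of_set (cube {-(int N - 1)..int N - 1} \<times> cube T))"
    using N fin unfolding M_def
    by (intro map_pmf_of_set_bij_betw[symmetric] bij_betw_map_prod bij_betw_toep_embed bij_betw_id finite_cartesian_product)
      (auto simp: cube_nonempty)
  also have "measure_pmf.prob (map_pmf (map_prod (toep_embed N) id) (pmf_of_set (cube {-(int N - 1)..int N - 1} \<times> cube T))) E
      = measure_pmf.prob (pmf_of_set (cube {-(int N - 1)..int N - 1} \<times> cube T)) (map_prod (toep_embed N) id -` E)"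
    by simp
  also have "\<dots> \<le> measure_pmf.prob (pmf_of_set (cube {-(int N - 1)..int N - 1} \<times> cube T))
     {(c, \<sigma>). l1_recovers N \<Omega> (toep_row N c) (signed_vec T m \<sigma>)}"
    using Om T by (intro measure_pmf.finite_measure_mono) (auto simp: E_def M_def intro: l1_recovers_toeplitz)
  finally show ?thesis .
qed

theorem theorem1:
  "\<exists>C>0. \<forall>(N::nat) (\<epsilon>::real) (\<Omega>::nat set) (s::nat) (T::nat set) (m::nat \<Rightarrow> real).
     N \<ge> 2 \<longrightarrow> 0 < \<epsilon> \<longrightarrow> \<epsilon> < 1 \<longrightarrow>
     \<Omega> \<subseteq> {..<N} \<longrightarrow> card \<Omega> < N \<longrightarrow>
     T \<subseteq> {..<N} \<longrightarrow> card T \<le> s \<longrightarrow> (\<forall>j\<in>T. m j > 0) \<longrightarrow>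
     real (card \<Omega>) \<ge> C * real s * (ln (real N / \<epsilon>)) ^ 3 \<longrightarrow>
       measure_pmf.prob
         (pmf_of_set ((PiE {..<N} (\<lambda>_. {-1::real, 1})) \<times> (PiE T (\<lambda>_. {-1::real, 1}))))
         {(b, \<sigma>). l1_recovers N \<Omega> (circ_row N b) (signed_vec T m \<sigma>)} \<ge> 1 - \<epsilon>
     \<and>
       measure_pmf.prob
         (pmf_of_set ((PiE {-(int N - 1)..int N - 1} (\<lambda>_. {-1::real, 1})) \<times> (PiE T (\<lambda>_. {-1::real, 1}))))
         {(c, \<sigma>). l1_recovers N \<Omega> (toep_row N c) (signed_vec T m \<sigma>)} \<ge> 1 - \<epsilon>"
\<comment> \<open>The Toeplitz constant serves both cases, as the logarithm is nonnegative.\<close>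
proof (intro exI[of _ "10 ^ 9"] conjI allI impI)
  fix N s :: nat and \<epsilon> :: real and \<Omega> T :: "nat set" and m :: "nat \<Rightarrow> real"
  assume *: "N \<ge> 2" "0 < \<epsilon>" "\<epsilon> < 1" "\<Omega> \<subseteq> {..<N}" "T \<subseteq> {..<N}" "card T \<le> s" "\<forall>j\<in>T. m j > 0"
    and n: "real (card \<Omega>) \<ge> 10 ^ 9 * real s * (ln (real N / \<epsilon>)) ^ 3"
  have "ln (real N / \<epsilon>) \<ge> 0" using * by (intro ln_ge_zero) (simp add: field_simps)
  hence "10 ^ 8 * real s * (ln (real N / \<epsilon>)) ^ 3 \<le> 10 ^ 9 * real s * (ln (real N / \<epsilon>)) ^ 3"
    by (intro mult_right_mono) auto
  with n have "real (card \<Omega>) \<ge> 10 ^ 8 * real s * (ln (real N / \<epsilon>)) ^ 3" by linarith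
  with * show "measure_pmf.prob (pmf_of_set (cube {..<N} \<times> cube T))
      {(b, \<sigma>). l1_recovers N \<Omega> (circ_row N b) (signed_vec T m \<sigma>)} \<ge> 1 - \<epsilon>"
    by (intro circulant_recovery) auto
  from * n show "measure_pmf.prob (pmf_of_set (cube {-(int N - 1)..int N - 1} \<times> cube T))
      {(c, \<sigma>). l1_recovers N \<Omega> (toep_row N c) (signed_vec T m \<sigma>)} \<ge> 1 - \<epsilon>"
    by (intro toeplitz_recovery) auto
qed simp

end
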